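(* Let $\ell\ge 4$ and $k \ge \ell+2$, and let $T_{k,\ell}$ be a $k$-vertex caterpillar with central path $v_1,\ldots,v_\ell$. Suppose $v_\ell$ has degree $2$ in $T_{k,\ell}$. Then for all $n\ge (k+1)2^{\ell-2}$, $$\mathrm{sat}^\ast(n,T_{k,\ell}) \le n+(\ell-3)2^{\ell-3}.$$
   Context: All graphs are finite and simple. An edge-colouring of a graph is proper if any two distinct edges sharing a vertex receive different colours. A rainbow copy of $H$ in an edge-coloured graph $G$ is a subgraph of $G$ isomorphic to $H$ all of whose edges have distinct colours. A graph $G$ is properly rainbow $H$-saturated if (1) there is a proper edge-colouring of $G$ containing no rainbow copy of $H$, and (2) for every non-edge $e \notin E(G)$ (a pair of distinct non-adjacent vertices of $G$), every proper edge-colouring of $G+e$ contains a rainbow copy of $H$. The proper rainbow saturation number $\mathrm{sat}^\ast(n,H)$ is the minimum number of edges in a properly rainbow $H$-saturated graph on $n$ vertices. A tree $T$ is a caterpillar if the tree obtained by deleting all leaves of $T$ is a path; this path is called the central path of $T$. *)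

theory Defs
  imports Main
begin

datatype 'a graph = Graph (verts: "'a set") (edges: "'a set set")

definition simple_graph :: "'a graph \<Rightarrow> bool" where
  "simple_graph G \<longleftrightarrow> finite (verts G) \<and>
     edges G \<subseteq> {{u, v} | u v. u \<in> verts G \<and> v \<in> verts G \<and> u \<noteq> v}"

definition degree :: "'a graph \<Rightarrow> 'a \<Rightarrow> nat" where
  "degree G v = card {e \<in> edges G. v \<in> e}"

definition add_edge :: "'a graph \<Rightarrow> 'a \<Rightarrow> 'a \<Rightarrow> 'a graph" where
  "add_edge G u v = Graph (verts G) (insert {u, v} (edges G))"

definition induced_subgraph :: "'a graph \<Rightarrow> 'a set \<Rightarrow> 'a graph" where
  "induced_subgraph G S = Graph (verts G \<inter> S) {e \<in> edges G. e \<subseteq> S}"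

definition subgraph :: "'a graph \<Rightarrow> 'a graph \<Rightarrow> bool" where
  "subgraph K G \<longleftrightarrow> simple_graph K \<and> verts K \<subseteq> verts G \<and> edges K \<subseteq> edges G"

definition isomorphic :: "'a graph \<Rightarrow> 'b graph \<Rightarrow> bool" where
  "isomorphic G H \<longleftrightarrow> (\<exists>f. bij_betw f (verts G) (verts H) \<and>
     (\<forall>u \<in> verts G. \<forall>v \<in> verts G. {u, v} \<in> edges G \<longleftrightarrow> {f u, f v} \<in> edges H))"

definition connected_graph :: "'a graph \<Rightarrow> bool" where
  "connected_graph G \<longleftrightarrow> verts G \<noteq> {} \<and>
     (\<forall>u \<in> verts G. \<forall>v \<in> verts G. (u, v) \<in> {(x, y). {x, y} \<in> edges G}\<^sup>*)"

definition is_cycle :: "'a graph \<Rightarrow> 'a list \<Rightarrow> bool" where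
  "is_cycle G xs \<longleftrightarrow> length xs \<ge> 3 \<and> distinct xs \<and>
     (\<forall>i < length xs. {xs ! i, xs ! (Suc i mod length xs)} \<in> edges G)"

definition tree :: "'a graph \<Rightarrow> bool" where
  "tree T \<longleftrightarrow> simple_graph T \<and> connected_graph T \<and> (\<nexists>xs. is_cycle T xs)"

definition path_graph :: "'a list \<Rightarrow> 'a graph" where
  "path_graph vs = Graph (set vs) {{vs ! i, vs ! Suc i} | i. Suc i < length vs}"

definition leaves :: "'a graph \<Rightarrow> 'a set" where
  "leaves G = {v \<in> verts G. degree G v = 1}"

definition central_path :: "'a graph \<Rightarrow> 'a list \<Rightarrow> bool" where
  "central_path T vs \<longleftrightarrow> vs \<noteq> [] \<and> distinct vs \<and>
     induced_subgraph T (verts T - leaves T) = path_graph vs"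

definition caterpillar :: "'a graph \<Rightarrow> bool" where
  "caterpillar T \<longleftrightarrow> tree T \<and> (\<exists>vs. central_path T vs)"

text \<open>Colours are natural numbers; as all graphs are finite, a larger palette would give the
  same notions below. Only the values of a colouring on the edges of the graph matter.\<close>

definition proper_edge_colouring :: "'a graph \<Rightarrow> ('a set \<Rightarrow> nat) \<Rightarrow> bool" where
  "proper_edge_colouring G c \<longleftrightarrow>
     (\<forall>e \<in> edges G. \<forall>f \<in> edges G. e \<noteq> f \<and> e \<inter> f \<noteq> {} \<longrightarrow> c e \<noteq> c f)"

definition has_rainbow_copy :: "'a graph \<Rightarrow> ('a set \<Rightarrow> nat) \<Rightarrow> 'b graph \<Rightarrow> bool" where
  "has_rainbow_copy G c H \<longleftrightarrow>
     (\<exists>K. subgraph K G \<and> isomorphic K H \<and> inj_on c (edges K))"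

definition properly_rainbow_saturated :: "'b graph \<Rightarrow> 'a graph \<Rightarrow> bool" where
  "properly_rainbow_saturated H G \<longleftrightarrow> simple_graph G \<and>
     (\<exists>c. proper_edge_colouring G c \<and> \<not> has_rainbow_copy G c H) \<and>
     (\<forall>u \<in> verts G. \<forall>v \<in> verts G. u \<noteq> v \<and> {u, v} \<notin> edges G \<longrightarrow>
        (\<forall>c. proper_edge_colouring (add_edge G u v) c \<longrightarrow>
           has_rainbow_copy (add_edge G u v) c H))"

text \<open>Host graphs may be taken with natural numbers as vertices, since saturation is invariant
  under isomorphism. The lemma after the definition shows that the minimum is over a nonempty
  set whenever \<open>H\<close> has an edge.\<close>

definition sat_star :: "nat \<Rightarrow> 'b graph \<Rightarrow> nat" where
  "sat_star n H = (LEAST m. \<exists>G :: nat graph.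
     card (verts G) = n \<and> properly_rainbow_saturated H G \<and> card (edges G) = m)"

lemma ex_properly_rainbow_saturated:
  fixes H :: "'b graph"
  assumes H: "simple_graph H" "edges H \<noteq> {}"
  shows "\<exists>G :: nat graph. card (verts G) = n \<and> properly_rainbow_saturated H G"
proof -
  define P where "P G \<longleftrightarrow> simple_graph G \<and> verts G = {..<n} \<and>
    (\<exists>c. proper_edge_colouring G c \<and> \<not> has_rainbow_copy G c H)" for G :: "nat graph"
  have sub: "edges G \<subseteq> Pow {..<n}" if "P G" for G
    using that unfolding P_def simple_graph_def by auto
  have bound: "card (edges G) < Suc (card (Pow {..<n}))" if "P G" for G
    using card_mono[OF _ sub[OF that]] by (simp add: less_Suc_eq_le)
  obtain a b where ab: "{a, b} \<in> edges H" "a \<in> verts H" "b \<in> verts H"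
    using H unfolding simple_graph_def by blast
  have "\<not> has_rainbow_copy (Graph {..<n} {} :: nat graph) c H" for c
  proof
    assume "has_rainbow_copy (Graph {..<n} {}) c H"
    then obtain K :: "nat graph" where K: "edges K = {}" "isomorphic K H"
      unfolding has_rainbow_copy_def subgraph_def by auto
    then obtain f where f: "f ` verts K = verts H"
      "\<forall>u \<in> verts K. \<forall>v \<in> verts K. {f u, f v} \<notin> edges H"
      unfolding isomorphic_def bij_betw_def by auto
    moreover have "a \<in> f ` verts K" "b \<in> f ` verts K"
      using f(1) ab by auto
    ultimately show False using ab(1) by blast
  qed
  then have "P (Graph {..<n} {})"
    unfolding P_def simple_graph_def proper_edge_colouring_def by auto
  from ex_has_greatest_nat[of P, OF this, of "\<lambda>G. card (edges G)"] bound less_imp_le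
  obtain G where G: "P G" and max: "\<And>G'. P G' \<Longrightarrow> card (edges G') \<le> card (edges G)"
    by blast
  have fin: "finite (edges G)"
    using sub[OF G] finite_subset by blast
  have "has_rainbow_copy (add_edge G u v) c H"
    if uv: "u \<in> verts G" "v \<in> verts G" "u \<noteq> v" "{u, v} \<notin> edges G"
      and c: "proper_edge_colouring (add_edge G u v) c" for u v c
  proof (rule ccontr)
    assume "\<not> has_rainbow_copy (add_edge G u v) c H"
    moreover have "simple_graph (add_edge G u v)"
      using G uv unfolding P_def simple_graph_def add_edge_def by auto
    moreover have "verts (add_edge G u v) = {..<n}"
      using G unfolding P_def add_edge_def by simp
    ultimately have "P (add_edge G u v)"
      using c unfolding P_def by blast
    from max[OF this] fin uv show False
      unfolding add_edge_def by simp
  qed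
  with G show ?thesis
    unfolding P_def properly_rainbow_saturated_def by (intro exI[of _ G]) auto
qed

end

theory Submission
  imports Defs
begin

text \<open>
  Put \<open>m = \<ell> - 2\<close>. The host is the folded cube on \<open>2\<^sup>m\<close> vertices, the Cayley graph of
  \<open>\<int>\<^sub>2\<^sup>m\<close> for the \<open>m\<close> unit vectors and their sum, with the remaining vertices hung evenly
  on it as leaves. Coloured by direction, a rainbow path with \<open>m + 1\<close> edges in the cube would use
  every direction once and hence close up; so there is no room for the central path.

  For saturation, take any proper colouring. From any vertex walk greedily, at step \<open>j\<close> choosing an
  edge whose colour is new and whose direction is not among the last \<open>m + 1 - j\<close> directions used;
  a count shows that this is always possible, also at the cost of one step less when one direction
  is forbidden at every vertex. Such a walk never uses every direction an even number of times in
  any window, so it can revisit a vertex only by closing up after \<open>m + 1\<close> distinct directions.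
  If there is no rainbow path with \<open>m + 1\<close> cube edges, then every edge lies on such a closed
  rainbow walk, and this forces all cube vertices to see the same set of \<open>m + 1\<close> colours.
  A new edge is then extended by a greedy walk with \<open>m\<close> edges avoiding its colour or its other
  end, and the leaves of the caterpillar are embedded greedily.
\<close>

section \<open>Paths\<close>

text \<open>The edges are kept as a list in path order, so that a path is rainbow exactly when the
  list of its colours is distinct.\<close>

fun path_edges :: "'a list \<Rightarrow> 'a set list" where
  "path_edges (x # y # zs) = {x, y} # path_edges (y # zs)"
| "path_edges zs = []"

lemma length_path_edges [simp]: "length (path_edges ps) = length ps - 1"
  by (induction ps rule: path_edges.induct) auto

lemma nth_path_edges: "Suc i < length ps \<Longrightarrow> path_edges ps ! i = {ps ! i, ps ! Suc i}"
proof (induction ps arbitrary: i rule: path_edges.induct)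
  case (1 x y zs)
  then show ?case by (cases i) auto
qed auto

lemma set_path_edges: "set (path_edges ps) = {{ps ! i, ps ! Suc i} | i. Suc i < length ps}"
proof -
  have "set (path_edges ps) = {path_edges ps ! i | i. Suc i < length ps}"
    by (simp add: set_conv_nth less_diff_conv)
  also have "\<dots> = {{ps ! i, ps ! Suc i} | i. Suc i < length ps}"
    by (intro Collect_cong ex_cong1) (auto simp: nth_path_edges)
  finally show ?thesis .
qed

lemma path_edges_snoc:
  "ps \<noteq> [] \<Longrightarrow> path_edges (ps @ [x]) = path_edges ps @ [{last ps, x}]"
  by (induction ps rule: path_edges.induct) auto

lemma path_edges_rev: "path_edges (rev ps) = rev (path_edges ps)"
proof (induction ps rule: path_edges.induct)
  case (1 x y zs)
  then show ?case using path_edges_snoc[of "rev (y # zs)" x]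
    by (simp add: insert_commute last_rev)
qed auto

lemma path_edges_map: "path_edges (map f ps) = map ((`) f) (path_edges ps)"
  by (induction ps rule: path_edges.induct) auto

lemma path_edges_subset: "e \<in> set (path_edges ps) \<Longrightarrow> e \<subseteq> set ps"
  by (induction ps rule: path_edges.induct) auto

section \<open>Walks in the folded cube\<close>

text \<open>Vectors over \<open>Z_2\<close> are coded as naturals below \<open>2 ^ m\<close> with
  \<open>xor\<close> as addition; index \<open>m\<close> stands for the all-ones vector, the sum of
  the unit vectors.\<close>

definition gen :: "nat \<Rightarrow> nat \<Rightarrow> nat" where
  "gen m i = (if i < m then 2 ^ i else mask m)"

definition step :: "nat \<Rightarrow> nat \<Rightarrow> nat \<Rightarrow> nat" where
  "step m v i = xor v (gen m i)"

abbreviation walk :: "nat \<Rightarrow> nat \<Rightarrow> nat list \<Rightarrow> nat" where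
  "walk m \<equiv> foldl (step m)"

fun trail :: "nat \<Rightarrow> nat \<Rightarrow> nat list \<Rightarrow> nat list" where
  "trail m a [] = [a]"
| "trail m a (x # xs) = a # trail m (step m a x) xs"

lemma less_iff_take_bit: "(v::nat) < 2 ^ m \<longleftrightarrow> take_bit m v = v"
  by (simp add: take_bit_nat_eq_self_iff)

lemma gen_less: "gen m i < 2 ^ m"
  by (auto simp: gen_def mask_eq_exp_minus_1)

lemma step_less: "v < 2 ^ m \<Longrightarrow> step m v i < 2 ^ m"
  using gen_less[of m i] by (simp add: step_def less_iff_take_bit)

lemma step_step [simp]: "step m (step m v i) i = v"
  by (simp add: step_def xor.assoc)

lemma gen_inj: "2 \<le> m \<Longrightarrow> i \<le> m \<Longrightarrow> j \<le> m \<Longrightarrow> gen m i = gen m j \<Longrightarrow> i = j"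
proof -
  have *: "(2::nat) ^ i \<noteq> mask m" if "2 \<le> m" for i
  proof
    assume "(2::nat) ^ i = mask m"
    then have "bit ((2::nat) ^ i) n = bit (mask m :: nat) n" for n by simp
    \<comment> \<open>A power of two has a single bit set, while the mask has bits 0 and 1 set as
      \<open>m\<close> is at least 2. For \<open>m = 1\<close> the two generators would
      coincide.\<close>
    then have "n = i \<longleftrightarrow> n < m" for n by (simp add: bit_simps)
    from this[of 0] this[of 1] that show False by auto
  qed
  assume "2 \<le> m" "i \<le> m" "j \<le> m" "gen m i = gen m j"
  then show ?thesis using *[of i] *[of j] by (auto simp: gen_def split: if_splits)
qed

lemma gen_nonzero: "2 \<le> m \<Longrightarrow> gen m i \<noteq> 0"
  by (auto simp: gen_def)

lemma xor_cancel: "xor (v::nat) g = xor v h \<longleftrightarrow> g = h"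
  by (metis xor.left_neutral xor.assoc xor_self_eq)

lemma step_inj: "2 \<le> m \<Longrightarrow> i \<le> m \<Longrightarrow> j \<le> m \<Longrightarrow> step m v i = step m v j \<Longrightarrow> i = j"
  unfolding step_def xor_cancel by (rule gen_inj)

lemma step_neq: "2 \<le> m \<Longrightarrow> step m v i \<noteq> v"
  using gen_nonzero[of m i] xor_cancel[of v "gen m i" 0] by (simp add: step_def)

lemma bit_step: "i < m \<Longrightarrow> x \<le> m \<Longrightarrow> bit (step m v x) i \<longleftrightarrow> bit v i \<noteq> (x = i \<or> x = m)"
  by (auto simp: step_def gen_def bit_simps)

lemma walk_less: "a < 2 ^ m \<Longrightarrow> walk m a xs < 2 ^ m"
  by (induction xs arbitrary: a) (auto simp: step_less)

text \<open>Only the directions \<open>i\<close> and \<open>m\<close> flip bit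
  \<open>i\<close>.\<close>

lemma bit_walk:
  assumes "i < m" "set xs \<subseteq> {..m}"
  shows "bit (walk m a xs) i \<longleftrightarrow> bit a i \<noteq> odd (count_list xs i + count_list xs m)"
  using assms(2)
proof (induction xs arbitrary: a)
  case (Cons x xs)
  then show ?case using assms(1) bit_step[of i m x a] by auto
qed simp

text \<open>The generators sum to zero, and this is their only linear relation.\<close>
lemma walk_eq_iff:
  assumes "a < 2 ^ m" "set xs \<subseteq> {..m}"
  shows "walk m a xs = a \<longleftrightarrow> (\<forall>i\<le>m. even (count_list xs i) = even (count_list xs m))"
proof -
  have "walk m a xs = a \<longleftrightarrow> (\<forall>i<m. bit (walk m a xs) i = bit a i)"
    using walk_less[OF assms(1), of xs] assms(1)
    by (auto simp: less_iff_take_bit) (metis bit_take_bit_iff bit_eqI)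
  also have "\<dots> \<longleftrightarrow> (\<forall>i<m. even (count_list xs i) = even (count_list xs m))"
    using bit_walk[OF _ assms(2), of _ a] by auto
  finally show ?thesis using nat_less_le by auto
qed

lemma length_trail [simp]: "length (trail m a xs) = Suc (length xs)"
  by (induction xs arbitrary: a) auto

lemma trail_not_Nil [simp]: "trail m a xs \<noteq> []"
  by (cases xs) auto

lemma hd_trail [simp]: "hd (trail m a xs) = a"
  by (cases xs) auto

lemma trail_snoc: "trail m a (xs @ [x]) = trail m a xs @ [step m (walk m a xs) x]"
  by (induction xs arbitrary: a) auto

lemma last_trail [simp]: "last (trail m a xs) = walk m a xs"
  by (induction xs arbitrary: a) auto

lemma set_trail_less: "a < 2 ^ m \<Longrightarrow> set (trail m a xs) \<subseteq> {..<2 ^ m}"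
  by (induction xs arbitrary: a) (auto simp: step_less)

lemma nth_trail: "i \<le> length xs \<Longrightarrow> trail m a xs ! i = walk m a (take i xs)"
proof (induction xs arbitrary: a i)
  case (Cons x xs)
  then show ?case by (cases i) auto
qed simp

text \<open>A repeated vertex amounts to a nonempty block of consecutive steps that closes up;
  \<open>drop i (take k xs)\<close> is the block of steps \<open>i\<close> to \<open>k - 1\<close>.
  In this form \<open>walk_eq_iff\<close> applies to each block.\<close>

lemma distinct_trail_iff:
  "distinct (trail m a xs) \<longleftrightarrow>
    (\<forall>k\<le>length xs. \<forall>i<k. walk m (walk m a (take i xs)) (drop i (take k xs)) \<noteq> walk m a (take i xs))"
proof -
  have *: "walk m (walk m a (take i xs)) (drop i (take k xs)) = trail m a xs ! k"
    if "i < k" "k \<le> length xs" for i k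
  proof -
    have "take k xs = take i xs @ drop i (take k xs)"
      using that by (metis append_take_drop_id min.absorb1 nat_less_le take_take)
    then show ?thesis using that by (metis foldl_append nth_trail)
  qed
  show ?thesis
    unfolding distinct_conv_nth using *
    by (auto simp: nth_trail less_Suc_eq_le)
       (metis linorder_neqE_nat nth_trail order.strict_implies_order order_trans)+
qed

section \<open>Direction sequences whose repetitions are far apart\<close>

text \<open>Entry \<open>j\<close> has to differ from the entries at positions
  \<open>2 * j - t\<close> to \<open>j - 1\<close>, that is, from the last \<open>t - j\<close>
  directions (from all earlier ones if there are fewer). The demand weakens as colours get used up
  along a walk.\<close>

definition spread :: "nat \<Rightarrow> nat list \<Rightarrow> bool" where
  "spread t xs \<longleftrightarrow> (\<forall>j<length xs. \<forall>i<j. xs ! i = xs ! j \<longrightarrow> i + t < 2 * j)"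

text \<open>In a window starting at position \<open>i\<close> every repetition sits at a position beyond
  \<open>(i + t) / 2\<close>, whereas in an even window at least half of the positions are repetitions.\<close>
lemma spread_not_even:
  assumes sp: "spread t xs" and k: "i < k" "k \<le> length xs" "k \<le> t"
  shows "\<exists>x. odd (count_list (drop i (take k xs)) x)"
proof (rule ccontr)
  assume "\<not> ?thesis"
  then have ev: "even (count_list (drop i (take k xs)) x)" for x by blast
  define NF where "NF = {q \<in> {i..<k}. \<exists>p\<in>{i..<q}. xs ! p = xs ! q}"
  \<comment> \<open>An entry with a positive even count occurs at least twice, so each first
    occurrence in the window has a later partner.\<close>
  have later: "\<exists>q\<in>NF. xs ! q = xs ! p" if p: "p \<in> {i..<k} - NF" for p
  proof -
    define ys where "ys = drop i (take k xs)"
    have ly: "length ys = k - i" and ny: "\<And>q. q < k - i \<Longrightarrow> ys ! q = xs ! (i + q)"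
      using k by (auto simp: ys_def)
    have "p - i < length ys" "ys ! (p - i) = xs ! p" using p ly ny[of "p - i"] by auto
    then have "xs ! p \<in> set ys" by (metis nth_mem)
    then have "count_list ys (xs ! p) \<noteq> 0" by (simp add: count_list_0_iff)
    moreover have "even (count_list ys (xs ! p))" using ev by (simp add: ys_def)
    ultimately have "count_list ys (xs ! p) \<ge> 2"
      by (metis One_nat_def Suc_leI bot_nat_0.not_eq_extremum dvd_imp_le)
    then have "card {q. q < length ys \<and> xs ! p = ys ! q} \<ge> 2"
      by (simp add: count_list_eq_length_filter length_filter_conv_card)
    then have "\<not> {q. q < length ys \<and> xs ! p = ys ! q} \<subseteq> {p - i}"
      using card_mono[of "{p - i}" "{q. q < length ys \<and> xs ! p = ys ! q}"] by auto
    then obtain q where "q < length ys" "xs ! p = ys ! q" "q \<noteq> p - i" by auto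
    then have q: "q < k - i" "xs ! p = xs ! (i + q)" "q \<noteq> p - i"
      using ly ny by auto
    have "\<not> i + q < p" using q p by (auto simp: NF_def)
    then have "i + q \<in> NF" using q p by (auto simp: NF_def)
    then show ?thesis using q by metis
  qed
  then obtain f where f: "\<And>p. p \<in> {i..<k} - NF \<Longrightarrow> f p \<in> NF \<and> xs ! f p = xs ! p" by metis
  \<comment> \<open>First occurrences carry distinct entries and a partner carries the same entry,
    so partners are distinct.\<close>
  have "inj_on f ({i..<k} - NF)"
  proof
    fix p q assume pq: "p \<in> {i..<k} - NF" "q \<in> {i..<k} - NF" "f p = f q"
    then have "xs ! p = xs ! q" using f by metis
    then show "p = q" using pq(1,2) by (auto simp: NF_def) (metis atLeastLessThan_iff nat_neq_iff)
  qed
  moreover have "f ` ({i..<k} - NF) \<subseteq> NF" using f by blast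
  moreover have fin: "finite NF" by (auto simp: NF_def)
  ultimately have "card ({i..<k} - NF) \<le> card NF" by (metis card_inj_on_le)
  moreover have "card ({i..<k} - NF) = card {i..<k} - card NF"
    using fin by (intro card_Diff_subset) (auto simp: NF_def)
  ultimately have half: "k - i \<le> 2 * card NF" by simp
  have "NF \<subseteq> {(i + t) div 2 + 1..<k}"
  proof
    fix q assume "q \<in> NF"
    then obtain p where p: "i \<le> p" "p < q" "xs ! p = xs ! q" "q < k" by (auto simp: NF_def)
    then have "p + t < 2 * q" using sp k by (auto simp: spread_def)
    then show "q \<in> {(i + t) div 2 + 1..<k}" using p by auto
  qed
  then have "card NF \<le> k - ((i + t) div 2 + 1)" by (metis card_atLeastLessThan card_mono finite_atLeastLessThan)
  \<comment> \<open>With \<open>k\<close> at most \<open>t\<close>, twice the bound on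
    \<open>card NF\<close> is at most \<open>k - i - 1\<close>.\<close>
  then show False using half k by auto
qed

text \<open>In a closed block all counts have the same parity, and spreading makes one of them odd;
  so every direction occurs, and the length bound leaves only the whole sequence with each direction
  once.\<close>

lemma spread_trail:
  assumes a: "a < 2 ^ m" and xs: "set xs \<subseteq> {..m}" and sp: "spread t xs"
    and len: "length xs \<le> t" "length xs \<le> Suc m"
  shows "distinct (trail m a xs) \<or>
    (length xs = Suc m \<and> distinct xs \<and> distinct (trail m a (butlast xs)))"
proof -
  have win: "i = 0 \<and> k = Suc m \<and> distinct xs"
    if ik: "i < k" "k \<le> length xs"
      and eq: "walk m (walk m a (take i xs)) (drop i (take k xs)) = walk m a (take i xs)" for i k
  proof -
    define ys where "ys = drop i (take k xs)"
    have sy: "set ys \<subseteq> {..m}" using xs by (auto simp: ys_def dest!: in_set_dropD in_set_takeD)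
    have "\<forall>x\<le>m. even (count_list ys x) = even (count_list ys m)"
      using eq unfolding ys_def[symmetric] by (rule walk_eq_iff[OF walk_less[OF a] sy, THEN iffD1])
    moreover obtain x where x: "odd (count_list ys x)"
      using spread_not_even[OF sp ik] ik len by (auto simp: ys_def)
    moreover have "x \<le> m" using x sy by (metis atMost_iff count_notin even_zero subsetD)
    ultimately have od: "odd (count_list ys y)" if "y \<le> m" for y using that by blast
    then have "{..m} \<subseteq> set ys" by (metis atMost_iff count_notin even_zero subsetI)
    then have "set ys = {..m}" using sy by auto
    then have "Suc m \<le> length ys" by (metis card_atMost card_length)
    moreover have "length ys = k - i" using ik by (simp add: ys_def)
    ultimately have "i = 0" "k = Suc m" "length xs = Suc m" using ik len by auto
    then have "ys = xs" by (simp add: ys_def)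
    then show ?thesis using \<open>i = 0\<close> \<open>k = Suc m\<close> \<open>set ys = {..m}\<close> \<open>length xs = Suc m\<close>
      by (metis card_atMost card_distinct)
  qed
  show ?thesis
  proof (cases "distinct (trail m a xs)")
    case False
    then obtain k i where "k \<le> length xs" "i < k"
      "walk m (walk m a (take i xs)) (drop i (take k xs)) = walk m a (take i xs)"
      unfolding distinct_trail_iff by blast
    then have *: "length xs = Suc m" "distinct xs" using win[of i k] len by auto
    \<comment> \<open>Without its last step the sequence has only \<open>m\<close> steps, too few
      for a block that closes up.\<close>
    have "distinct (trail m a (butlast xs))"
      unfolding distinct_trail_iff
    proof (intro allI impI notI)
      fix k i assume k: "k \<le> length (butlast xs)" "i < k"
        and eq: "walk m (walk m a (take i (butlast xs))) (drop i (take k (butlast xs))) = walk m a (take i (butlast xs))"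
      have "k < length xs" "i < length xs" using k * by auto
      then have "take i (butlast xs) = take i xs" "take k (butlast xs) = take k xs"
        by (simp_all add: take_butlast)
      then have "k = Suc m" using win[OF k(2)] eq \<open>k < length xs\<close> by simp
      then show False using k * by simp
    qed
    then show ?thesis using * by blast
  qed blast
qed

section \<open>Rainbow paths in the folded cube\<close>

definition folded_cube :: "nat \<Rightarrow> nat graph" where
  "folded_cube m = Graph {..<2 ^ m} {{v, step m v i} | v i. v < 2 ^ m \<and> i \<le> m}"

definition colours_at :: "nat \<Rightarrow> (nat set \<Rightarrow> nat) \<Rightarrow> nat \<Rightarrow> nat set" where
  "colours_at m c v = (\<lambda>i. c {v, step m v i}) ` {..m}"

abbreviation trail_colours :: "nat \<Rightarrow> (nat set \<Rightarrow> nat) \<Rightarrow> nat \<Rightarrow> nat list \<Rightarrow> nat list" where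
  "trail_colours m c a xs \<equiv> map c (path_edges (trail m a xs))"

definition rainbow_path :: "nat \<Rightarrow> (nat set \<Rightarrow> nat) \<Rightarrow> nat \<Rightarrow> nat list \<Rightarrow> bool" where
  "rainbow_path m c a xs \<longleftrightarrow>
    set xs \<subseteq> {..m} \<and> distinct (trail m a xs) \<and> distinct (trail_colours m c a xs)"

lemma proper_edge_colouring_mono:
  "proper_edge_colouring G c \<Longrightarrow> edges H \<subseteq> edges G \<Longrightarrow> proper_edge_colouring H c"
  unfolding proper_edge_colouring_def by blast

lemma proper_edge_colouringD:
  "proper_edge_colouring G c \<Longrightarrow> e \<in> edges G \<Longrightarrow> f \<in> edges G \<Longrightarrow> v \<in> e \<Longrightarrow> v \<in> f \<Longrightarrow>
    c e = c f \<Longrightarrow> e = f"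
  unfolding proper_edge_colouring_def by (metis IntI empty_iff)

lemma count_list_distinct: "distinct xs \<Longrightarrow> x \<in> set xs \<Longrightarrow> count_list xs x = 1"
  by (induction xs) auto

lemma folded_cube_edgeI: "v < 2 ^ m \<Longrightarrow> i \<le> m \<Longrightarrow> {v, step m v i} \<in> edges (folded_cube m)"
  by (auto simp: folded_cube_def)

lemma path_edges_trail_Cons:
  "path_edges (trail m a (x # xs)) = {a, step m a x} # path_edges (trail m (step m a x) xs)"
  by (cases xs) auto

lemma path_edges_trail_snoc:
  "path_edges (trail m a (xs @ [x])) =
    path_edges (trail m a xs) @ [{walk m a xs, step m (walk m a xs) x}]"
  by (simp add: trail_snoc path_edges_snoc)

lemma path_edges_trail_subset:
  "a < 2 ^ m \<Longrightarrow> set xs \<subseteq> {..m} \<Longrightarrow> set (path_edges (trail m a xs)) \<subseteq> edges (folded_cube m)"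
  by (induction xs arbitrary: a)
     (auto simp: path_edges_trail_Cons step_less folded_cube_edgeI simp del: trail.simps(2))

lemma trail_colours_subset:
  "a < 2 ^ m \<Longrightarrow> set xs \<subseteq> {..m} \<Longrightarrow> (\<And>v. v < 2 ^ m \<Longrightarrow> colours_at m c v = K) \<Longrightarrow>
    set (trail_colours m c a xs) \<subseteq> K"
proof (induction xs arbitrary: a)
  case (Cons x xs)
  have "c {a, step m a x} \<in> colours_at m c a" using Cons.prems by (auto simp: colours_at_def)
  then show ?case using Cons.IH[of "step m a x"] Cons.prems
    by (auto simp: path_edges_trail_Cons step_less simp del: trail.simps(2))
qed simp

lemma spread_snoc:
  "spread t (xs @ [x]) \<longleftrightarrow> spread t xs \<and> (\<forall>i<length xs. xs ! i = x \<longrightarrow> i + t < 2 * length xs)"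
  by (auto simp: spread_def nth_append less_Suc_eq all_conj_distrib)

section \<open>Greedy walks with distinct colours\<close>

context
  fixes m :: nat and c :: "nat set \<Rightarrow> nat"
  assumes m: "2 \<le> m" and proper: "proper_edge_colouring (folded_cube m) c"
begin

lemma colour_inj:
  assumes "v < 2 ^ m"
  shows "inj_on (\<lambda>i. c {v, step m v i}) {..m}"
proof
  fix i j assume ij: "i \<in> {..m}" "j \<in> {..m}" "c {v, step m v i} = c {v, step m v j}"
  have "{v, step m v i} \<in> edges (folded_cube m)" "{v, step m v j} \<in> edges (folded_cube m)"
    using assms ij by (auto intro: folded_cube_edgeI)
  then have "{v, step m v i} = {v, step m v j}"
    using proper_edge_colouringD[OF proper, of _ _ v] ij(3) by simp
  then have "step m v i = step m v j" by (metis doubleton_eq_iff)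
  then show "i = j" using step_inj[OF m] ij by auto
qed

lemma card_colours_at: "v < 2 ^ m \<Longrightarrow> card (colours_at m c v) = Suc m"
  unfolding colours_at_def by (simp add: card_image colour_inj)

text \<open>With \<open>n = length xs\<close>, at most \<open>n\<close> directions are excluded by
  used colours, \<open>card B\<close> by choice and fewer than \<open>t - n\<close> by spreading: in
  total fewer than \<open>t + card B\<close>, so one of the \<open>m + 1\<close> directions is
  left.\<close>

lemma greedy_step:
  assumes a: "a < 2 ^ m" and xs: "xs \<noteq> []" "length xs < t" "set xs \<subseteq> {..m}"
    and sp: "spread t xs" and rb: "distinct (trail_colours m c a xs)"
    and B: "B \<subseteq> {..m}" "t + card B \<le> Suc m"
  shows "\<exists>x\<le>m. x \<notin> B \<and> spread t (xs @ [x]) \<and> distinct (trail_colours m c a (xs @ [x]))"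
proof -
  let ?v = "walk m a xs" and ?n = "length xs"
  define U where "U = {i \<in> {..m}. c {?v, step m ?v i} \<in> set (trail_colours m c a xs)}"
  have v: "?v < 2 ^ m" using a by (rule walk_less)
  have "card U \<le> card (set (trail_colours m c a xs))"
    by (rule card_inj_on_le[of "\<lambda>i. c {?v, step m ?v i}"])
       (use colour_inj[OF v] in \<open>auto simp: U_def intro: inj_on_subset\<close>)
  also have "\<dots> \<le> ?n" using card_length[of "trail_colours m c a xs"] by simp
  finally have U: "card U \<le> ?n" .
  obtain ys y where ys: "xs = ys @ [y]" using xs(1) by (metis rev_exhaust)
  \<comment> \<open>The latest direction leads back along the last edge, whose colour is used. Being
    counted in \<open>U\<close>, it is left out of \<open>L\<close>; this saves the one direction
    needed.\<close>
  have "{?v, step m ?v y} = {walk m a ys, step m (walk m a ys) y}" by (auto simp: ys)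
  then have "y \<in> U" using xs by (auto simp: U_def ys path_edges_trail_snoc)
  define L where "L = (!) xs ` {2 * ?n - t..<?n - 1}"
  have "card L \<le> ?n - 1 - (2 * ?n - t)"
    unfolding L_def using card_image_le[of "{2 * ?n - t..<?n - 1}" "(!) xs"] by simp
  moreover have "0 < ?n" using xs by simp
  ultimately have "card L < t - ?n" using xs(2) by linarith
  moreover have "finite L" "finite U" "finite B" using B by (auto simp: L_def U_def intro: finite_subset)
  ultimately have "card (U \<union> B \<union> L) < Suc m"
    using U B(2) xs(2) card_Un_le[of "U \<union> B" L] card_Un_le[of U B] by linarith
  then have "\<not> {..m} \<subseteq> U \<union> B \<union> L"
    using card_mono[of "U \<union> B \<union> L" "{..m}"] \<open>finite L\<close> \<open>finite U\<close> \<open>finite B\<close> by auto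
  then obtain x where x: "x \<le> m" "x \<notin> U" "x \<notin> B" "x \<notin> L" by auto
  have "i + t < 2 * ?n" if i: "i < ?n" "xs ! i = x" for i
  proof (rule ccontr)
    assume "\<not> i + t < 2 * ?n"
    moreover have "i \<noteq> ?n - 1" using i x \<open>y \<in> U\<close> by (auto simp: ys)
    ultimately have "i \<in> {2 * ?n - t..<?n - 1}" using i by auto
    then show False using i x by (auto simp: L_def)
  qed
  then show ?thesis using x rb sp by (intro exI[of _ x]) (auto simp: spread_snoc path_edges_trail_snoc U_def)
qed

text \<open>\<open>B v\<close> holds the directions forbidden at vertex \<open>v\<close>. The budget
  allows length \<open>m + 1\<close> with nothing forbidden, or length \<open>m\<close> with one
  direction forbidden at each vertex.\<close>

lemma greedy_walk:
  assumes a: "a < 2 ^ m" and x: "x \<le> m" "x \<notin> B a" and t: "1 \<le> t"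
    and B: "\<And>v. B v \<subseteq> {..m}" "\<And>v. t + card (B v) \<le> Suc m"
  shows "\<exists>xs. length xs = t \<and> hd xs = x \<and> set xs \<subseteq> {..m} \<and> spread t xs \<and>
    distinct (trail_colours m c a xs) \<and> (\<forall>j<t. xs ! j \<notin> B (walk m a (take j xs)))"
proof -
  \<comment> \<open>The induction builds prefixes of every length \<open>n\<close> while
    \<open>t\<close> stays fixed, since how far apart repetitions must be depends on the final
    length.\<close>
  have "n \<le> t \<longrightarrow> (\<exists>xs. length xs = n \<and> hd xs = x \<and> set xs \<subseteq> {..m} \<and> spread t xs \<and>
    distinct (trail_colours m c a xs) \<and> (\<forall>j<n. xs ! j \<notin> B (walk m a (take j xs))))" if "1 \<le> n" for n
    using that
  proof (induction n rule: dec_induct)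
    case base
    show ?case using x by (intro impI exI[of _ "[x]"]) (auto simp: spread_def)
  next
    case (step n)
    show ?case
    proof
      assume "Suc n \<le> t"
      then obtain xs where xs: "length xs = n" "hd xs = x" "set xs \<subseteq> {..m}" "spread t xs"
        "distinct (trail_colours m c a xs)" "\<forall>j<n. xs ! j \<notin> B (walk m a (take j xs))"
        using step.IH by auto
      have ne: "xs \<noteq> []" using xs(1) step(1) by auto
      then obtain y where y: "y \<le> m" "y \<notin> B (walk m a xs)" "spread t (xs @ [y])"
        "distinct (trail_colours m c a (xs @ [y]))"
        using greedy_step[OF a, of xs t "B (walk m a xs)"] xs B step(1) \<open>Suc n \<le> t\<close> by auto
      show "\<exists>xs. length xs = Suc n \<and> hd xs = x \<and> set xs \<subseteq> {..m} \<and> spread t xs \<and>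
        distinct (trail_colours m c a xs) \<and> (\<forall>j<Suc n. xs ! j \<notin> B (walk m a (take j xs)))"
        using xs y ne by (intro exI[of _ "xs @ [y]"]) (auto simp: nth_append less_Suc_eq)
    qed
  qed
  from this[OF t] show ?thesis by blast
qed

text \<open>A walk that uses every direction once closes up; hence it is a rainbow cycle through all its
  vertices, and any further edge at its start must repeat one of its colours.\<close>
lemma closed_walk_colours:
  assumes none: "\<And>a xs. a < 2 ^ m \<Longrightarrow> length xs = Suc m \<Longrightarrow> \<not> rainbow_path m c a xs"
    and a: "a < 2 ^ m" and xs: "distinct xs" "set xs = {..m}"
    and rb: "distinct (trail_colours m c a xs)" "distinct (trail m a (butlast xs))"
  shows "colours_at m c a = set (trail_colours m c a xs)"
\<comment> \<open>Both sets have \<open>m + 1\<close> elements, so one inclusion is enough.\<close>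
proof (rule card_subset_eq)
  have len: "length xs = Suc m" using xs by (metis card_atMost distinct_card)
  then show "card (colours_at m c a) = card (set (trail_colours m c a xs))"
    using distinct_card[OF rb(1)] card_colours_at[OF a] by simp
  have one: "count_list xs i = 1" if "i \<le> m" for i
    using xs that by (intro count_list_distinct) auto
  obtain ys z where ys: "xs = ys @ [z]" using len by (metis length_Suc_conv list.distinct(1) rev_exhaust)
  have closed: "walk m a xs = a" using walk_eq_iff[OF a, of xs] xs one by auto
  have "step m (walk m a ys) z = a" using closed by (simp add: ys)
  \<comment> \<open>Cut open at its last edge, the cycle is a path from \<open>a\<close> to the
    neighbour of \<open>a\<close> in direction \<open>z\<close>.\<close>
  then have z: "walk m a ys = step m a z" by (metis step_step)
  show "colours_at m c a \<subseteq> set (trail_colours m c a xs)"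
  proof
    fix k assume "k \<in> colours_at m c a"
    then obtain y where y: "y \<le> m" "k = c {a, step m a y}" by (auto simp: colours_at_def)
    show "k \<in> set (trail_colours m c a xs)"
    proof (rule ccontr)
      \<comment> \<open>A colour at \<open>a\<close> missing from the cycle would prolong this path
        backwards beyond \<open>a\<close> to a rainbow path with \<open>m + 1\<close> edges,
        provided \<open>?b\<close> is off the path.\<close>
      assume k: "k \<notin> set (trail_colours m c a xs)"
      have yz: "y \<noteq> z"
        using k y by (auto simp: ys path_edges_trail_snoc z insert_commute)
      let ?b = "step m a y"
      have b: "?b < 2 ^ m" by (rule step_less[OF a])
      \<comment> \<open>If the path met \<open>?b\<close>, then \<open>zs\<close> would be closed
        and miss \<open>z\<close>, so all its counts would be even. But either
        \<open>zs = [y]\<close>, or its first direction \<open>w\<close> occurs exactly once: it is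
        not repeated along the path, and it is not \<open>y\<close> because \<open>k\<close> is not
        the colour of the first edge.\<close>
      have "?b \<notin> set (trail m a ys)"
      proof
        assume "?b \<in> set (trail m a ys)"
        then obtain j where j: "j \<le> length ys" "walk m a (take j ys) = ?b"
          by (auto simp: in_set_conv_nth less_Suc_eq_le nth_trail)
        define zs where "zs = take j ys @ [y]"
        have zs: "set zs \<subseteq> {..m}" "z \<notin> set zs" using xs y yz
          by (auto simp: zs_def ys dest: in_set_takeD)
        moreover have "walk m a zs = a" using j by (simp add: zs_def)
        ultimately have ev: "even (count_list zs i)" if "i \<le> m" for i
          using walk_eq_iff[OF a zs(1)] that xs(2) ys
          by (metis count_notin even_zero in_set_conv_decomp atMost_iff)
        have "take j ys = [y]"
        proof (cases ys)
          case Nil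
          then show ?thesis using len m ys by simp
        next
          case (Cons w ws)
          show ?thesis
          proof (cases j)
            case 0
            then show ?thesis using ev[OF y(1)] by (simp add: zs_def)
          next
            case (Suc i)
            have "w \<noteq> y"
              using k y by (auto simp: ys Cons path_edges_trail_Cons simp del: trail.simps(2))
            moreover have "w \<notin> set ws" "w \<le> m" using xs by (auto simp: ys Cons)
            moreover have "count_list (take i ws) w = 0" for i
              using \<open>w \<notin> set ws\<close> by (metis count_notin in_set_takeD)
            ultimately show ?thesis using ev[of w] Suc Cons by (simp add: zs_def)
          qed
        qed
        then show False using k y j(1)
          by (cases ys; cases j) (auto simp: ys path_edges_trail_Cons simp del: trail.simps(2))
      qed
      moreover have "distinct (k # trail_colours m c a ys)"
        using k rb(1) by (auto simp: ys path_edges_trail_snoc)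
      moreover have "trail_colours m c ?b (y # ys) = k # trail_colours m c a ys"
        by (simp add: path_edges_trail_Cons y insert_commute del: trail.simps(2))
      ultimately have "rainbow_path m c ?b (y # ys)"
        using rb(2) xs y(1) unfolding rainbow_path_def by (auto simp: ys)
      then show False using none[OF b, of "y # ys"] len ys by simp
    qed
  qed
qed simp

text \<open>A greedy walk of length \<open>m + 1\<close> starting with \<open>x\<close> has to close
  up, as rainbow paths of this length are excluded. Rotating it by one step gives a closed walk from
  the other end of its first edge with the same edges, so both ends see exactly the colours of this
  one cycle.\<close>

lemma colours_at_step:
  assumes none: "\<And>a xs. a < 2 ^ m \<Longrightarrow> length xs = Suc m \<Longrightarrow> \<not> rainbow_path m c a xs"
    and a: "a < 2 ^ m" and x: "x \<le> m"
  shows "colours_at m c (step m a x) = colours_at m c a"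
proof -
  let ?b = "step m a x"
  obtain xs where xs: "length xs = Suc m" "hd xs = x" "set xs \<subseteq> {..m}" "spread (Suc m) xs"
    "distinct (trail_colours m c a xs)"
    using greedy_walk[OF a x, of "\<lambda>_. {}" "Suc m"] by auto
  then have d: "distinct xs" "distinct (trail m a (butlast xs))"
    using spread_trail[OF a xs(3,4)] none[OF a xs(1)] by (auto simp: rainbow_path_def)
  then have all: "set xs = {..m}"
    using xs by (intro card_subset_eq) (auto simp: distinct_card)
  obtain ys where ys: "xs = x # ys" using xs by (cases xs) auto
  have one: "count_list xs i = 1" if "i \<le> m" for i
    using d(1) all that by (intro count_list_distinct) auto
  have "walk m a xs = a" using walk_eq_iff[OF a xs(3)] one by auto
  then have cl: "walk m ?b ys = a" by (simp add: ys)
  have eq: "path_edges (trail m ?b (ys @ [x])) = path_edges (trail m ?b ys) @ [{a, ?b}]"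
    by (simp add: path_edges_trail_snoc cl)
  have eq': "path_edges (trail m a xs) = {a, ?b} # path_edges (trail m ?b ys)"
    by (simp add: ys path_edges_trail_Cons del: trail.simps(2))
  have "ys \<noteq> []" using xs m by (auto simp: ys)
  \<comment> \<open>With the repeated end vertex dropped, both closed walks visit the same vertices:
    \<open>a\<close> moves from the front to the end.\<close>
  then have "trail m a (butlast xs) = a # trail m ?b (butlast ys)" by (simp add: ys)
  moreover have "trail m ?b ys = trail m ?b (butlast ys) @ [a]"
    using trail_snoc[of m ?b "butlast ys" "last ys"] \<open>ys \<noteq> []\<close> cl
    by (metis append_butlast_last_id foldl_Cons foldl_Nil foldl_append)
  ultimately have "distinct (trail m ?b (butlast (ys @ [x])))" using d by auto
  then have "colours_at m c ?b = set (trail_colours m c ?b (ys @ [x]))"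
    using d all xs(5)[unfolded eq']
    by (intro closed_walk_colours none step_less a) (auto simp: ys eq simp del: trail.simps(2))
  also have "\<dots> = set (trail_colours m c a xs)" by (simp add: eq eq')
  also have "\<dots> = colours_at m c a"
    using closed_walk_colours[OF none a d(1) all xs(5) d(2)] by simp
  finally show ?thesis .
qed

section \<open>Rainbow paths with \<open>m\<close> edges that avoid a colour or a vertex\<close>

text \<open>With \<open>t = m\<close> a spread walk is too short to close up, and the step saved
  pays for one forbidden direction at each vertex.\<close>

lemma rainbow_path_avoiding:
  assumes a: "a < 2 ^ m" and B: "\<And>v. B v \<subseteq> {..m}" "\<And>v. card (B v) \<le> 1"
  shows "\<exists>xs. length xs = m \<and> rainbow_path m c a xs \<and> (\<forall>j<m. xs ! j \<notin> B (walk m a (take j xs)))"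
proof -
  have "\<not> {..m} \<subseteq> B a" using card_mono[of "B a" "{..m}"] B[of a] m finite_subset by fastforce
  then obtain x where x: "x \<le> m" "x \<notin> B a" by auto
  obtain xs where xs: "length xs = m" "set xs \<subseteq> {..m}" "spread m xs"
    "distinct (trail_colours m c a xs)" "\<forall>j<m. xs ! j \<notin> B (walk m a (take j xs))"
    using greedy_walk[where B = B and t = m, OF a x] B m by auto
  then have "distinct (trail m a xs)" using spread_trail[OF a xs(2,3)] by auto
  then show ?thesis using xs by (auto simp: rainbow_path_def)
qed

lemma rainbow_path_avoiding_colour:
  assumes a: "a < 2 ^ m"
  shows "\<exists>xs. length xs = m \<and> rainbow_path m c a xs \<and> k \<notin> set (trail_colours m c a xs)"
proof -
  \<comment> \<open>At most one edge at a vertex has colour \<open>k\<close>. The guard empties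
    \<open>B v\<close> outside the cube, where properness gives no bound.\<close>
  define B where "B v = {i \<in> {..m}. v < 2 ^ m \<and> c {v, step m v i} = k}" for v
  have "card (B v) \<le> 1" for v
    using colour_inj[of v] by (auto simp: B_def card_le_Suc0_iff_eq inj_on_def)
  then obtain xs where xs: "length xs = m" "rainbow_path m c a xs"
    "\<forall>j<m. xs ! j \<notin> B (walk m a (take j xs))"
    using rainbow_path_avoiding[OF a, of B] by (auto simp: B_def)
  have ne: "k \<noteq> c (path_edges (trail m a xs) ! j)" if j: "j < m" for j
  proof -
    have "xs ! j \<in> set xs" using xs(1) j by simp
    then have "xs ! j \<le> m" using xs(2) by (auto simp: rainbow_path_def)
    moreover have "path_edges (trail m a xs) ! j =
      {walk m a (take j xs), step m (walk m a (take j xs)) (xs ! j)}"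
      using xs(1) j by (simp add: nth_path_edges nth_trail take_Suc_conv_app_nth)
    ultimately show ?thesis using xs(3) j walk_less[OF a, of "take j xs"] by (auto simp: B_def)
  qed
  have "k \<notin> set (trail_colours m c a xs)"
  proof
    assume "k \<in> set (trail_colours m c a xs)"
    then obtain j where "j < length xs" "k = c (path_edges (trail m a xs) ! j)"
      by (auto simp: in_set_conv_nth)
    then show False using ne xs(1) by blast
  qed
  then show ?thesis using xs by blast
qed

lemma rainbow_path_avoiding_vertex:
  assumes a: "a < 2 ^ m" and b: "b \<noteq> a"
  shows "\<exists>xs. length xs = m \<and> rainbow_path m c a xs \<and> b \<notin> set (trail m a xs)"
proof -
  \<comment> \<open>At most one direction leads from a given vertex to \<open>b\<close>.\<close>
  define B where "B v = {i \<in> {..m}. step m v i = b}" for v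
  have "card (B v) \<le> 1" for v
    using step_inj[OF m] by (auto simp: B_def card_le_Suc0_iff_eq)
  then obtain xs where xs: "length xs = m" "rainbow_path m c a xs"
    "\<forall>j<m. xs ! j \<notin> B (walk m a (take j xs))"
    using rainbow_path_avoiding[OF a, of B] by (auto simp: B_def)
  have "b \<noteq> trail m a xs ! j" if "j \<le> m" for j
  proof (cases j)
    case (Suc i)
    then have "xs ! i \<in> set xs" using xs(1) that by simp
    then have "xs ! i \<le> m" using xs(2) unfolding rainbow_path_def by blast
    moreover have "trail m a xs ! j = step m (walk m a (take i xs)) (xs ! i)"
      using xs(1) that Suc by (simp add: nth_trail take_Suc_conv_app_nth)
    moreover have "xs ! i \<notin> B (walk m a (take i xs))" using xs(3) Suc that by simp
    ultimately show ?thesis by (auto simp: B_def)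
  qed (use b in \<open>simp add: nth_trail\<close>)
  then have "b \<notin> set (trail m a xs)" using xs(1) by (auto simp: in_set_conv_nth less_Suc_eq_le)
  then show ?thesis using xs by blast
qed

end

text \<open>The unit vectors alone connect the cube: a number whose top bit is at \<open>j\<close>
  arises from a smaller one by a step in direction \<open>j\<close>.\<close>

lemma folded_cube_induct [consumes 1, case_names zero step]:
  assumes "a < 2 ^ m" and "P 0" and "\<And>v i. v < 2 ^ m \<Longrightarrow> i \<le> m \<Longrightarrow> P v \<Longrightarrow> P (step m v i)"
  shows "P a"
proof -
  have "a < 2 ^ j \<Longrightarrow> P a" if "j \<le> m" for j a
    using that
  proof (induction j arbitrary: a)
    case (Suc j)
    show ?case
    proof (cases "a < 2 ^ j")
      case False
      define b where "b = a - 2 ^ j"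
      have b: "b < 2 ^ j" "a = b + 2 ^ j" using False Suc.prems by (auto simp: b_def)
      have "take_bit j b = b" using b(1) by (simp add: less_iff_take_bit)
      then have "\<not> bit b j" by (metis bit_take_bit_iff less_irrefl)
      \<comment> \<open>Bit \<open>j\<close> of \<open>b\<close> is clear, so adding
        \<open>2 ^ j\<close> is the same as \<open>xor\<close>.\<close>
      then have "and b (2 ^ j) = 0" by (intro bit_eqI) (auto simp: bit_simps)
      then have "a = step m b j" using Suc.prems
        by (simp add: b(2) step_def gen_def disjunctive_add_eq_xor)
      moreover have "b < 2 ^ m" using b(1) Suc.prems
        by (meson Suc_leD less_le_trans one_le_numeral power_increasing)
      ultimately show ?thesis using assms(3)[of b j] Suc.IH[of b] Suc.prems b(1) by simp
    qed (use Suc in auto)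
  qed (use assms(2) in auto)
  then show ?thesis using assms(1) by blast
qed

section \<open>Embedding caterpillars\<close>

text \<open>Copies are traded for injective vertex maps. \<open>K\<close> is the image of
  \<open>T\<close>, not the subgraph induced on it, so that the edge relation agrees in both
  directions, as \<open>isomorphic\<close> demands.\<close>

lemma has_rainbow_copyI:
  assumes T: "simple_graph T" and inj: "inj_on g (verts T)" and V: "g ` verts T \<subseteq> verts G"
    and E: "\<And>e. e \<in> edges T \<Longrightarrow> g ` e \<in> edges G" and rb: "inj_on (\<lambda>e. c (g ` e)) (edges T)"
  shows "has_rainbow_copy G c T"
proof -
  define K where "K = Graph (g ` verts T) ((`) g ` edges T)"
  have sub: "e \<subseteq> verts T" if "e \<in> edges T" for e
    using T that by (auto simp: simple_graph_def)
  have "simple_graph K"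
    unfolding simple_graph_def
  proof (intro conjI subsetI)
    show "finite (verts K)" using T by (simp add: K_def simple_graph_def)
    fix e assume "e \<in> edges K"
    then obtain e' where e': "e' \<in> edges T" "e = g ` e'" by (auto simp: K_def)
    then obtain u v where uv: "e' = {u, v}" "u \<in> verts T" "v \<in> verts T" "u \<noteq> v"
      using T by (auto simp: simple_graph_def)
    then have "g u \<noteq> g v" using inj by (auto dest: inj_onD)
    then show "e \<in> {{u, v} |u v. u \<in> verts K \<and> v \<in> verts K \<and> u \<noteq> v}"
      using uv e' by (auto simp: K_def)
  qed
  then have "subgraph K G" using V E by (auto simp: subgraph_def K_def)
  moreover have "isomorphic K T"
    unfolding isomorphic_def
  proof (intro exI[of _ "inv_into (verts T) g"] conjI ballI)
    show "bij_betw (inv_into (verts T) g) (verts K) (verts T)"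
      using inj by (simp add: K_def bij_betw_inv_into inj_on_imp_bij_betw)
    fix u v assume "u \<in> verts K" "v \<in> verts K"
    then obtain x y where xy: "x \<in> verts T" "y \<in> verts T" "u = g x" "v = g y" by (auto simp: K_def)
    have "{g x, g y} = g ` e \<longleftrightarrow> {x, y} = e" if "e \<in> edges T" for e
      using inj_on_image_eq_iff[OF inj, of "{x, y}" e] xy sub[OF that] by simp
    then have "{u, v} \<in> edges K \<longleftrightarrow> {x, y} \<in> edges T" by (auto simp: K_def xy image_iff)
    then show "{u, v} \<in> edges K \<longleftrightarrow> {inv_into (verts T) g u, inv_into (verts T) g v} \<in> edges T"
      using xy inj by simp
  qed
  moreover have "inj_on c (edges K)"
    using rb inj_on_imageI[of c "(`) g" "edges T"] by (simp add: K_def comp_def)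
  ultimately show ?thesis by (auto simp: has_rainbow_copy_def)
qed

lemma has_rainbow_copyD:
  assumes T: "simple_graph T" and "has_rainbow_copy G c T"
  obtains g where "inj_on g (verts T)" "g ` verts T \<subseteq> verts G"
    "\<And>e. e \<in> edges T \<Longrightarrow> g ` e \<in> edges G" "inj_on (\<lambda>e. c (g ` e)) (edges T)"
proof -
  obtain K f where K: "subgraph K G" "inj_on c (edges K)" and f: "bij_betw f (verts K) (verts T)"
    and fE: "\<And>u v. u \<in> verts K \<Longrightarrow> v \<in> verts K \<Longrightarrow> {u, v} \<in> edges K \<longleftrightarrow> {f u, f v} \<in> edges T"
    using assms(2) unfolding has_rainbow_copy_def isomorphic_def by blast
  define g where "g = inv_into (verts K) f"
  have g: "bij_betw g (verts T) (verts K)" unfolding g_def by (rule bij_betw_inv_into[OF f])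
  have fg: "f (g x) = x" if "x \<in> verts T" for x
    using bij_betw_inv_into_right[OF f that] by (simp add: g_def)
  have sub: "e \<subseteq> verts T" if "e \<in> edges T" for e
    using T that by (auto simp: simple_graph_def)
  have gE: "g ` e \<in> edges K" if e: "e \<in> edges T" for e
  proof -
    obtain x y where "e = {x, y}" "x \<in> verts T" "y \<in> verts T"
      using T e by (auto simp: simple_graph_def)
    then show ?thesis using fE[of "g x" "g y"] fg bij_betwE[OF g] e by simp
  qed
  have inj: "inj_on g (verts T)" using g by (rule bij_betw_imp_inj_on)
  have "inj_on (\<lambda>e. c (g ` e)) (edges T)"
  proof
    fix e e' assume e: "e \<in> edges T" "e' \<in> edges T" "c (g ` e) = c (g ` e')"
    then have "g ` e = g ` e'" using K(2) gE by (auto dest: inj_onD)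
    then show "e = e'" using inj_on_image_eq_iff[OF inj] sub e by blast
  qed
  moreover have "g ` verts T \<subseteq> verts G"
    using g K(1) by (auto simp: bij_betw_def subgraph_def)
  moreover have "edges K \<subseteq> edges G" using K(1) by (simp add: subgraph_def)
  ultimately show ?thesis using that[OF inj] gE by blast
qed

text \<open>The spine is the central path prolonged by the only leaf \<open>w\<close> at its last
  vertex; all other leaves hang on earlier vertices. An embedding may thus put the last two spine
  vertices where there is no room for leaves.\<close>

lemma caterpillar_structure:
  assumes cat: "caterpillar T" and vs: "central_path T vs" and l: "4 \<le> length vs"
    and deg: "degree T (last vs) = 2"
  obtains w p L where "simple_graph T" "distinct (vs @ [w])" "finite L" "L \<inter> set (vs @ [w]) = {}"
    "verts T = set (vs @ [w]) \<union> L" "p ` L \<subseteq> set (butlast vs)"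
    "edges T = set (path_edges (vs @ [w])) \<union> (\<lambda>u. {u, p u}) ` L"
    "\<And>v. v \<in> set vs \<Longrightarrow> 2 \<le> degree T v"
proof -
  have T: "simple_graph T" "connected_graph T" using cat by (auto simp: caterpillar_def tree_def)
  have ne: "vs \<noteq> []" using l by auto
  have dv: "distinct vs" using vs by (simp add: central_path_def)
  have ind: "verts T \<inter> (verts T - leaves T) = set vs"
    "{e \<in> edges T. e \<subseteq> verts T - leaves T} = set (path_edges vs)"
    using vs by (auto simp: central_path_def induced_subgraph_def path_graph_def set_path_edges)
  have lv: "leaves T \<subseteq> verts T" by (auto simp: leaves_def)
  have S: "set vs = verts T - leaves T" using ind(1) by auto
  have finV: "finite (verts T)" using T by (simp add: simple_graph_def)
  have finE: "finite (edges T)"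
    by (rule finite_subset[of _ "Pow (verts T)"]) (use T in \<open>auto simp: simple_graph_def\<close>)
  have "\<exists>q. {u, q} \<in> edges T \<and> q \<in> set vs \<and> (\<forall>e\<in>edges T. u \<in> e \<longrightarrow> e = {u, q})"
    if u: "u \<in> leaves T" for u
  proof -
    have "card {e \<in> edges T. u \<in> e} = 1" using u by (simp add: leaves_def degree_def)
    then obtain e where e: "{e \<in> edges T. u \<in> e} = {e}" by (auto simp: card_1_singleton_iff)
    then have "e \<in> edges T" "u \<in> e" by auto
    have eu: "f = e" if "f \<in> edges T" "u \<in> f" for f
    proof -
      have "f \<in> {e \<in> edges T. u \<in> e}" using that by simp
      then show ?thesis unfolding e by simp
    qed
    obtain x y where "e = {x, y}" "x \<in> verts T" "y \<in> verts T" "x \<noteq> y"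
      using T(1) \<open>e \<in> edges T\<close> by (auto simp: simple_graph_def)
    with \<open>u \<in> e\<close> obtain q where q: "e = {u, q}" "q \<in> verts T" "u \<noteq> q" by auto
    \<comment> \<open>Two adjacent leaves would form a component of their own, whereas
      \<open>T\<close> is connected and the central path is not empty.\<close>
    have "q \<in> set vs"
    proof (rule ccontr)
      assume "q \<notin> set vs"
      then have "q \<in> leaves T" using q S by auto
      then have "card {e \<in> edges T. q \<in> e} = 1" by (simp add: leaves_def degree_def)
      then obtain e' where *: "{e \<in> edges T. q \<in> e} = {e'}" by (auto simp: card_1_singleton_iff)
      have one: "f = e'" if "f \<in> edges T" "q \<in> f" for f
      proof -
        have "f \<in> {e \<in> edges T. q \<in> e}" using that by simp
        then show ?thesis unfolding * by simp
      qed
      have "e = e'" using \<open>e \<in> edges T\<close> q(1) by (intro one) simp_all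
      with one have e': "f = e" if "f \<in> edges T" "q \<in> f" for f using that by simp
      let ?R = "{(x, y). {x, y} \<in> edges T}"
      have "y \<in> {u, q}" if "(u, y) \<in> ?R\<^sup>*" for y
        using that
      proof (induction rule: rtrancl_induct)
        case (step y z)
        then have "{y, z} \<in> edges T" "u \<in> {y, z} \<or> q \<in> {y, z}" by auto
        then have "{y, z} = e" using e' eu by blast
        then show ?case using q(1) by blast
      qed simp
      moreover have "vs ! 0 \<in> set vs" using l by (intro nth_mem) linarith
      moreover have "(u, vs ! 0) \<in> ?R\<^sup>*"
        using T(2) lv u S \<open>vs ! 0 \<in> set vs\<close> unfolding connected_graph_def by blast
      ultimately show False using u \<open>q \<in> leaves T\<close> S by auto
    qed
    moreover have "f = {u, q}" if "f \<in> edges T" "u \<in> f" for f using eu[OF that] q(1) by simp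
    ultimately show ?thesis using \<open>e \<in> edges T\<close> q(1) by blast
  qed
  then obtain p where p: "\<And>u. u \<in> leaves T \<Longrightarrow> {u, p u} \<in> edges T"
    "\<And>u. u \<in> leaves T \<Longrightarrow> p u \<in> set vs"
    "\<And>u e. u \<in> leaves T \<Longrightarrow> e \<in> edges T \<Longrightarrow> u \<in> e \<Longrightarrow> e = {u, p u}" by metis
  have E: "edges T = set (path_edges vs) \<union> (\<lambda>u. {u, p u}) ` leaves T"
  proof (intro equalityI subsetI)
    fix e assume e: "e \<in> edges T"
    have "e \<subseteq> verts T" using T e by (auto simp: simple_graph_def)
    then show "e \<in> set (path_edges vs) \<union> (\<lambda>u. {u, p u}) ` leaves T"
    proof (cases "e \<inter> leaves T = {}")
      case True
      then have "e \<in> {e \<in> edges T. e \<subseteq> verts T - leaves T}" using e \<open>e \<subseteq> verts T\<close> by blast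
      then show ?thesis unfolding ind(2) by blast
    next
      case False
      then obtain u where "u \<in> e" "u \<in> leaves T" by blast
      then show ?thesis using p(3)[of u e] e by blast
    qed
  qed (use p(1) ind(2) in auto)
  define z where "z = last vs"
  have z: "z = vs ! (length vs - 1)" "z \<in> set vs"
    using ne by (auto simp: z_def last_conv_nth)
  \<comment> \<open>As an end of the central path, \<open>z\<close> lies on only one of its edges;
    the second edge at \<open>z\<close> given by \<open>deg\<close> therefore goes to a
    leaf.\<close>
  have path_z: "e = {vs ! (length vs - 2), z}" if mem: "e \<in> set (path_edges vs)" and ze: "z \<in> e" for e
  proof -
    obtain i where i: "Suc i < length vs" "e = {vs ! i, vs ! Suc i}"
      using mem unfolding set_path_edges by blast
    then have "i = length vs - 1 \<or> Suc i = length vs - 1"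
      using ze dv l unfolding z(1) by (auto simp: nth_eq_iff_index_eq)
    then have "Suc i = length vs - 1" using i by auto
    moreover from this have "i = length vs - 2" by linarith
    ultimately show ?thesis using i(2) z(1) by metis
  qed
  define e0 where "e0 = {vs ! (length vs - 2), z}"
  have e0: "e0 \<in> set (path_edges vs)"
  proof -
    have "length vs - 1 = Suc (length vs - 2)" "Suc (length vs - 2) < length vs" using l by linarith+
    then show ?thesis unfolding set_path_edges e0_def z(1) by auto
  qed
  then have "e0 \<in> {e \<in> edges T. z \<in> e}" using E by (auto simp: e0_def)
  then have "card ({e \<in> edges T. z \<in> e} - {e0}) = 1"
    using deg by (simp add: degree_def z_def)
  then obtain e1 where e1: "{e \<in> edges T. z \<in> e} - {e0} = {e1}" by (auto simp: card_1_singleton_iff)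
  then have "e1 \<in> edges T" "z \<in> e1" "e1 \<noteq> e0" by auto
  then have "e1 \<in> (\<lambda>u. {u, p u}) ` leaves T" using E path_z e0_def by auto
  then obtain w where w: "w \<in> leaves T" "e1 = {w, p w}" by auto
  then have pw: "p w = z" using \<open>z \<in> e1\<close> z(2) S by auto
  have uniq: "u = w" if u: "u \<in> leaves T" "p u = z" for u
  proof -
    have "{u, z} \<noteq> e0" using u path_edges_subset[OF e0] S by auto
    then have "{u, z} \<in> {e1}" unfolding e1[symmetric] using p(1)[OF u(1)] u by auto
    then show ?thesis using w pw u S z by (auto simp: doubleton_eq_iff)
  qed
  have pe: "path_edges (vs @ [w]) = path_edges vs @ [{w, p w}]"
    using ne pw by (subst path_edges_snoc) (auto simp: z_def insert_commute)
  show ?thesis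
  proof (rule that[of w "leaves T - {w}" p])
    show "distinct (vs @ [w])" using dv w S by auto
    show "finite (leaves T - {w})" using finV lv finite_subset by blast
    show "(leaves T - {w}) \<inter> set (vs @ [w]) = {}" using S by auto
    show "verts T = set (vs @ [w]) \<union> (leaves T - {w})" using S w lv by auto
    have "p u \<in> set (butlast vs)" if u: "u \<in> leaves T - {w}" for u
    proof -
      have "p u \<in> set vs" "p u \<noteq> z" using p(2) uniq u by auto
      moreover have "vs = butlast vs @ [z]" using ne by (simp add: z_def)
      ultimately show ?thesis
        by (metis Un_iff empty_iff insert_iff list.set set_append)
    qed
    then show "p ` (leaves T - {w}) \<subseteq> set (butlast vs)" by blast
    show "edges T = set (path_edges (vs @ [w])) \<union> (\<lambda>u. {u, p u}) ` (leaves T - {w})"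
      unfolding pe E using w by auto
    fix v assume v: "v \<in> set vs"
    then obtain i where i: "i < length vs" "v = vs ! i" by (auto simp: in_set_conv_nth)
    \<comment> \<open>Lying on a path edge excludes degree 0, and not being a leaf excludes degree
      1.\<close>
    have "\<exists>e\<in>set (path_edges vs). v \<in> e"
    proof (cases "Suc i < length vs")
      case False
      then have "{vs ! (i - 1), v} \<in> set (path_edges vs)"
        unfolding set_path_edges using i l by (intro CollectI exI[of _ "i - 1"]) auto
      then show ?thesis by blast
    qed (use i in \<open>auto simp: set_path_edges\<close>)
    then have "degree T v \<noteq> 0" using finE E by (auto simp: degree_def)
    moreover have "degree T v \<noteq> 1" using v S by (auto simp: leaves_def)
    ultimately show "2 \<le> degree T v" by linarith
  qed (fact T(1))
qed

section \<open>Greedy choice of the leaves\<close>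

lemma fresh_neighbour:
  assumes proper: "proper_edge_colouring G c" and S: "\<And>x. x \<in> S \<Longrightarrow> {a, x} \<in> edges G"
    and Q: "finite Q" "card Q < card S"
  shows "\<exists>x\<in>S. c {a, x} \<notin> Q"
proof -
  have "inj_on (\<lambda>x. c {a, x}) S"
  proof
    fix x y assume xy: "x \<in> S" "y \<in> S" "c {a, x} = c {a, y}"
    then have "{a, x} = {a, y}"
      by (intro proper_edge_colouringD[OF proper, of _ _ a] S) auto
    then show "x = y" by (auto simp: doubleton_eq_iff)
  qed
  then have "card Q < card ((\<lambda>x. c {a, x}) ` S)" using Q by (simp add: card_image)
  then have "\<not> (\<lambda>x. c {a, x}) ` S \<subseteq> Q" using card_mono[OF Q(1)] leD by blast
  then show ?thesis by auto
qed

text \<open>Properness already separates a new edge at \<open>a\<close> in colour from the edges of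
  \<open>F\<close> through \<open>a\<close>; only the colours of the edges of \<open>F\<close>
  missing \<open>a\<close> and of the leaf edges chosen before remain to be avoided.\<close>

lemma rainbow_leaf_choice:
  assumes proper: "proper_edge_colouring G c" and "finite U" and F: "finite F" "F \<subseteq> edges G"
    and r: "r ` U \<subseteq> A"
    and N: "\<And>a. a \<in> A \<Longrightarrow> finite (N a)" "\<And>a x. a \<in> A \<Longrightarrow> x \<in> N a \<Longrightarrow> {a, x} \<in> edges G \<and> x \<notin> \<Union>F"
    and room: "\<And>a. a \<in> A \<Longrightarrow> card {e \<in> F. a \<notin> e} + card U \<le> card (N a)"
  shows "\<exists>h. (\<forall>u\<in>U. h u \<in> N (r u)) \<and> inj_on (\<lambda>u. c {r u, h u}) U \<and>
    (\<forall>u\<in>U. c {r u, h u} \<notin> c ` F)"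
  using \<open>finite U\<close> r room
proof (induction U)
  case (insert u U)
  have "card {e \<in> F. a \<notin> e} + card U \<le> card (N a)" if "a \<in> A" for a
    using insert.prems(2)[OF that] insert.hyps by simp
  then obtain h where h: "\<forall>u\<in>U. h u \<in> N (r u)" "inj_on (\<lambda>u. c {r u, h u}) U"
    "\<forall>u\<in>U. c {r u, h u} \<notin> c ` F"
    using insert.IH insert.prems by auto
  define a where "a = r u"
  have a: "a \<in> A" using insert.prems by (simp add: a_def)
  define Q where "Q = c ` {e \<in> F. a \<notin> e} \<union> (\<lambda>u. c {r u, h u}) ` U"
  have fin: "finite Q" unfolding Q_def using F(1) insert.hyps(1) by simp
  have "card Q \<le> card (c ` {e \<in> F. a \<notin> e}) + card ((\<lambda>u. c {r u, h u}) ` U)"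
    unfolding Q_def by (rule card_Un_le)
  also have "\<dots> \<le> card {e \<in> F. a \<notin> e} + card U"
    by (intro add_mono card_image_le) (simp_all add: F(1) insert.hyps(1))
  also have "\<dots> < card (N a)" using insert.prems(2)[OF a] insert.hyps by simp
  finally obtain x where x: "x \<in> N a" "c {a, x} \<notin> Q"
    using fresh_neighbour[OF proper _ fin, of "N a" a] N(2)[OF a] by blast
  have xF: "c {a, x} \<notin> c ` F"
  proof
    assume "c {a, x} \<in> c ` F"
    then obtain e where e: "e \<in> F" "c {a, x} = c e" by auto
    then have "a \<in> e" using x by (auto simp: Q_def)
    then have "{a, x} = e" using N(2)[OF a x(1)] e F(2)
      by (intro proper_edge_colouringD[OF proper, of _ _ a]) auto
    then show False using N(2)[OF a x(1)] e(1) by blast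
  qed
  have nu: "v \<noteq> u" if "v \<in> U" for v using that insert.hyps by auto
  have eq: "(\<lambda>v. c {r v, (h(u := x)) v}) ` U = (\<lambda>v. c {r v, h v}) ` U"
    using nu by (intro image_cong) auto
  have "inj_on (\<lambda>v. c {r v, (h(u := x)) v}) U"
    using h(2) nu by (auto simp: inj_on_def)
  then have "inj_on (\<lambda>v. c {r v, (h(u := x)) v}) (insert u U)"
    using x(2) insert.hyps(2) eq by (auto simp: Q_def a_def)
  moreover have "\<forall>v\<in>insert u U. (h(u := x)) v \<in> N (r v)" "\<forall>v\<in>insert u U. c {r v, (h(u := x)) v} \<notin> c ` F"
    using h x xF nu by (auto simp: a_def)
  ultimately show ?case by blast
qed simp

text \<open>Spine vertices carrying leaves are sent into \<open>A\<close>, where each has its own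
  pool \<open>N a\<close> of neighbours outside \<open>A\<close>. Only the last two vertices of
  \<open>ps\<close> may leave \<open>A\<close> and so occupy pool vertices; removing them costs each
  pool at most two.\<close>

lemma rainbow_caterpillar:
  assumes T: "simple_graph T" and ts: "distinct ts" "finite L" "L \<inter> set ts = {}"
      "verts T = set ts \<union> L" "p ` L \<subseteq> set (take (length ts - 2) ts)"
      "edges T = set (path_edges ts) \<union> (\<lambda>u. {u, p u}) ` L"
    and proper: "proper_edge_colouring G c"
    and ps: "length ps = length ts" "distinct ps" "set ps \<subseteq> verts G" "set (path_edges ps) \<subseteq> edges G"
      "distinct (map c (path_edges ps))"
    and two: "2 \<le> length ps" and A: "set (take (length ps - 2) ps) \<subseteq> A"
    and N: "\<And>a. a \<in> A \<Longrightarrow> finite (N a) \<and> N a \<subseteq> verts G - A \<and> card (verts T) \<le> card (N a)"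
      "\<And>a x. a \<in> A \<Longrightarrow> x \<in> N a \<Longrightarrow> {a, x} \<in> edges G"
      "\<And>a b. a \<in> A \<Longrightarrow> b \<in> A \<Longrightarrow> a \<noteq> b \<Longrightarrow> N a \<inter> N b = {}"
  shows "has_rainbow_copy G c T"
proof -
  let ?n = "length ts"
  define g where "g x = the (map_of (zip ts ps) x)" for x
  have gnth: "g (ts ! i) = ps ! i" if "i < ?n" for i
    using that ts(1) ps(1) by (simp add: g_def map_of_zip_nth)
  then have g: "map g ts = ps" using ps(1) by (intro nth_equalityI) auto
  have gp: "g (p u) \<in> set (take (?n - 2) ps)" if "u \<in> L" for u
  proof -
    have "p u \<in> set (take (?n - 2) ts)" using that ts(5) by auto
    then show ?thesis unfolding g[symmetric] by (simp add: take_map)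
  qed
  define A' where "A' = set (take (?n - 2) ps)"
  have A': "A' \<subseteq> A" using A ps(1) by (simp add: A'_def)
  define X where "X = set (drop (?n - 2) ps)"
  have psAX: "set ps = A' \<union> X" by (metis A'_def X_def append_take_drop_id set_append)
  have cX: "card X \<le> 2" using card_length[of "drop (?n - 2) ps"] ps(1) by (simp add: X_def)
  define F where "F = set (path_edges ps)"
  have cF: "card F \<le> ?n - 1" using card_length[of "path_edges ps"] ps(1) by (simp add: F_def)
  \<comment> \<open>At most \<open>?n - 2\<close> spine edges miss \<open>a\<close>, and
    \<open>card L\<close> is \<open>card (verts T) - ?n\<close>. The sum is at most
    \<open>card (verts T) - 2\<close>, and the pool still offers that many after losing
    \<open>X\<close>.\<close>
  have room: "card {e \<in> F. a \<notin> e} + card L \<le> card (N a - X)" if a: "a \<in> A'" for a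
  proof -
    have "a \<in> set ps" using a psAX by auto
    then obtain i where i: "i < length ps - 2" "ps ! i = a"
      using a by (auto simp: A'_def in_set_conv_nth ps(1))
    then have "{ps ! i, ps ! Suc i} \<in> F" unfolding F_def set_path_edges by auto
    then have "{e \<in> F. a \<notin> e} \<subset> F" using i by auto
    then have "card {e \<in> F. a \<notin> e} < card F" by (intro psubset_card_mono) (simp_all add: F_def)
    moreover have "card (verts T) = ?n + card L"
      using ts by (simp add: card_Un_disjoint distinct_card inf_commute)
    moreover have "card (N a) - card X \<le> card (N a - X)" by (rule diff_card_le_card_Diff) (simp add: X_def)
    moreover have "card (verts T) \<le> card (N a)" using N(1) a A' by auto
    moreover have "2 \<le> ?n" using two ps(1) by simp
    ultimately show ?thesis using cX cF by linarith
  qed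
  have disj: "x \<notin> set ps" if "a \<in> A'" "x \<in> N a - X" for a x
    using that N(1)[of a] A' psAX by auto
  obtain h where h: "\<forall>u\<in>L. h u \<in> N (g (p u)) - X" "inj_on (\<lambda>u. c {g (p u), h u}) L"
    "\<forall>u\<in>L. c {g (p u), h u} \<notin> c ` F"
  proof -
    have "\<exists>h. (\<forall>u\<in>L. h u \<in> N (g (p u)) - X) \<and> inj_on (\<lambda>u. c {g (p u), h u}) L \<and>
      (\<forall>u\<in>L. c {g (p u), h u} \<notin> c ` F)"
    proof (rule rainbow_leaf_choice[OF proper ts(2)])
      show "(\<lambda>u. g (p u)) ` L \<subseteq> A'" using gp by (auto simp: A'_def)
      show "{a, x} \<in> edges G \<and> x \<notin> \<Union>F" if "a \<in> A'" "x \<in> N a - X" for a x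
        using that N(2)[of a x] A' disj[OF that] path_edges_subset by (fastforce simp: F_def)
    qed (use room ps(4) N(1) A' in \<open>auto simp: F_def\<close>)
    then show ?thesis using that by blast
  qed
  have hps: "h u \<notin> set ps" "g (p u) \<in> A" if "u \<in> L" for u
    using that h(1) disj[of "g (p u)" "h u"] gp[OF that] A' by (auto simp: A'_def)
  define f where "f x = (if x \<in> L then h x else g x)" for x
  have fg: "f x = g x" if "x \<in> set ts" for x using that ts(3) by (auto simp: f_def)
  have fp: "f (p u) = g (p u)" if "u \<in> L" for u
    using that ts(5) fg by (meson image_subset_iff in_set_takeD)
  have fh: "f u = h u" if "u \<in> L" for u using that by (simp add: f_def)
  have fl: "f ` {u, p u} = {g (p u), h u}" if "u \<in> L" for u
    using fp[OF that] fh[OF that] by (simp add: insert_commute)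
  have fe: "f ` e = g ` e" if "e \<in> set (path_edges ts)" for e
    using path_edges_subset[OF that] fg by (intro image_cong) auto
  have peg: "(`) g ` set (path_edges ts) = F" unfolding F_def g[symmetric] path_edges_map by simp
  show ?thesis
  proof (rule has_rainbow_copyI[OF T, of f])
    have "inj_on g (set ts)" using ps(2) unfolding g[symmetric] by (simp add: distinct_map)
    then have "inj_on f (set ts)" using fg by (simp add: inj_on_def)
    \<comment> \<open>Equal images lie in the same pool, as pools are disjoint; they then give the
      same edge, and the chosen colours are injective on \<open>L\<close>.\<close>
    moreover have "inj_on h L"
    proof
      fix u v assume uv: "u \<in> L" "v \<in> L" "h u = h v"
      have "h u \<in> N (g (p u)) \<inter> N (g (p v))" using h(1) uv by auto
      then have "g (p u) = g (p v)" using N(3)[OF hps(2)[OF uv(1)] hps(2)[OF uv(2)]] by blast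
      then show "u = v" using inj_onD[OF h(2) _ uv(1,2)] uv(3) by simp
    qed
    then have "inj_on f L" by (simp add: f_def inj_on_def)
    moreover have "f ` set ts = set ps" unfolding g[symmetric] using fg by auto
    moreover have "f ` L \<inter> set ps = {}" using hps by (auto simp: f_def)
    ultimately show "inj_on f (verts T)"
      unfolding ts(4) by (subst inj_on_Un) (use ts(3) in blast)
    show "f ` verts T \<subseteq> verts G"
    proof -
      have "f ` L \<subseteq> verts G" using h(1) hps(2) N(1) by (fastforce simp: f_def)
      then show ?thesis unfolding ts(4) using \<open>f ` set ts = set ps\<close> ps(3) by auto
    qed
    show "f ` e \<in> edges G" if e: "e \<in> edges T" for e
    proof (cases "e \<in> set (path_edges ts)")
      case True
      then show ?thesis using fe peg ps(4) by (auto simp: F_def)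
    next
      case False
      then obtain u where u: "u \<in> L" "e = {u, p u}" using e ts(6) by auto
      then have "f ` e = {g (p u), h u}" using fl by simp
      then show ?thesis using u h(1) N(2) hps by auto
    qed
    have "distinct (map (\<lambda>e. c (g ` e)) (path_edges ts))"
      using ps(5) unfolding g[symmetric] path_edges_map by (simp add: comp_def)
    then have "inj_on (\<lambda>e. c (g ` e)) (set (path_edges ts))" by (simp add: distinct_map)
    then have i1: "inj_on (\<lambda>e. c (f ` e)) (set (path_edges ts))" using fe by (simp cong: inj_on_cong)
    have i2: "inj_on (\<lambda>e. c (f ` e)) ((\<lambda>u. {u, p u}) ` L)"
      by (rule inj_on_imageI) (use h(2) fl in \<open>simp add: comp_def cong: inj_on_cong\<close>)
    have "(\<lambda>e. c (f ` e)) ` set (path_edges ts) = c ` F"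
      using fe by (simp add: peg[symmetric] image_image)
    moreover have "(\<lambda>e. c (f ` e)) ` (\<lambda>u. {u, p u}) ` L = (\<lambda>u. c {g (p u), h u}) ` L"
      using fl by (simp add: image_image)
    moreover have "c ` F \<inter> (\<lambda>u. c {g (p u), h u}) ` L = {}"
      using h(3) by (intro Int_emptyI) (metis (no_types, lifting) imageE)
    ultimately have "(\<lambda>e. c (f ` e)) ` set (path_edges ts) \<inter> (\<lambda>e. c (f ` e)) ` (\<lambda>u. {u, p u}) ` L = {}"
      by simp
    then show "inj_on (\<lambda>e. c (f ` e)) (edges T)"
      unfolding ts(6) inj_on_Un using i1 i2 by blast
  qed
qed

section \<open>The host graph\<close>

text \<open>Reduction modulo \<open>2 ^ m\<close> deals the leaves out evenly over the cube.\<close>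

definition host :: "nat \<Rightarrow> nat \<Rightarrow> nat graph" where
  "host m n = Graph {..<n}
    (edges (folded_cube m) \<union> (\<lambda>x. {x mod 2 ^ m, x}) ` {2 ^ m..<n})"

definition pendants :: "nat \<Rightarrow> nat \<Rightarrow> nat \<Rightarrow> nat set" where
  "pendants m n a = {x \<in> {2 ^ m..<n}. x mod 2 ^ m = a}"

text \<open>A cube edge gets its direction; a pendant edge gets a colour of its own above
  \<open>m\<close>, since \<open>Max e\<close> is its leaf.\<close>

definition direction_colouring :: "nat \<Rightarrow> nat set \<Rightarrow> nat" where
  "direction_colouring m e = (if e \<subseteq> {..<2 ^ m} then THE i. i \<le> m \<and> (\<exists>v. e = {v, step m v i})
    else Suc m + Max e)"

text \<open>This is what the lower bound on \<open>n\<close> provides: the numbers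
  \<open>a + 2 ^ m * t\<close> for \<open>t\<close> from 1 to \<open>k\<close> all stay below
  \<open>n\<close>.\<close>

lemma card_pendants:
  assumes a: "a < 2 ^ m" and n: "(k + 1) * 2 ^ m \<le> n"
  shows "k \<le> card (pendants m n a)"
proof -
  have inj: "inj_on (\<lambda>t. a + 2 ^ m * t) {1..k}" by (auto simp: inj_on_def)
  have "(\<lambda>t. a + 2 ^ m * t) ` {1..k} \<subseteq> pendants m n a"
  proof safe
    fix t assume t: "t \<in> {1..k}"
    have "2 ^ m * t \<le> 2 ^ m * k" "2 ^ m * 1 \<le> 2 ^ m * t" using t by (intro mult_le_mono; simp)+
    moreover have "2 ^ m * k + 2 ^ m \<le> n" using n by (simp add: algebra_simps)
    ultimately have "2 ^ m \<le> a + 2 ^ m * t" "a + 2 ^ m * t < n" using a by linarith+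
    then show "a + 2 ^ m * t \<in> pendants m n a" using a by (simp add: pendants_def)
  qed
  then have "card {1..k} \<le> card (pendants m n a)"
    by (intro card_inj_on_le[OF inj]) (auto simp: pendants_def)
  then show ?thesis by simp
qed

lemma simple_host:
  assumes "2 \<le> m" "2 ^ m \<le> n"
  shows "simple_graph (host m n)"
proof -
  have "e \<in> {{u, v} | u v. u \<in> {..<n} \<and> v \<in> {..<n} \<and> u \<noteq> v}" if "e \<in> edges (host m n)" for e
  proof -
    from that consider v i where "v < 2 ^ m" "e = {v, step m v i}"
      | x where "2 ^ m \<le> x" "x < n" "e = {x mod 2 ^ m, x}"
      by (auto simp: host_def folded_cube_def)
    then show ?thesis
    proof cases
      case 1
      then show ?thesis
        using step_less[of v m i] step_neq[OF assms(1), of v i] assms(2) by force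
    next
      case 2
      have "x mod 2 ^ m < 2 ^ m" by simp
      then have "x mod 2 ^ m < n" "x mod 2 ^ m \<noteq> x" using 2 by linarith+
      then show ?thesis using 2 by blast
    qed
  qed
  then show ?thesis unfolding simple_graph_def by (auto simp: host_def)
qed

lemma step_edge_eq: "v \<in> {x, step m x i} \<Longrightarrow> {x, step m x i} = {v, step m v i}"
  by auto

text \<open>The edges of one direction form a perfect matching of the cube.\<close>

lemma card_direction:
  assumes m: "2 \<le> m"
  shows "2 * card ((\<lambda>v. {v, step m v i}) ` {..<2 ^ m}) = 2 ^ m"
proof -
  let ?C = "(\<lambda>v. {v, step m v i}) ` {..<2 ^ m}"
  have "\<Union> ?C = {..<2 ^ m}" using step_less[of _ m i] by auto
  moreover have "2 * card ?C = card (\<Union> ?C)"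
  proof (rule card_partition)
    show "finite (\<Union> ?C)" by auto
    show "card e = 2" if "e \<in> ?C" for e
    proof -
      obtain v where "e = {v, step m v i}" using \<open>e \<in> ?C\<close> by auto
      then show ?thesis using step_neq[OF m, of v i] by (simp add: card_insert_if)
    qed
    show "e \<inter> f = {}" if "e \<in> ?C" "f \<in> ?C" "e \<noteq> f" for e f
    proof (rule ccontr)
      assume "e \<inter> f \<noteq> {}"
      moreover obtain v w where vw: "e = {v, step m v i}" "f = {w, step m w i}"
        using \<open>e \<in> ?C\<close> \<open>f \<in> ?C\<close> by auto
      ultimately obtain x where "x \<in> e" "x \<in> f" by blast
      then have "e = f" using step_edge_eq[of x v m i] step_edge_eq[of x w m i] vw by simp
      then show False using \<open>e \<noteq> f\<close> by simp
    qed
  qed simp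
  ultimately show ?thesis by simp
qed

lemma card_edges_host:
  assumes m: "2 \<le> m"
  shows "card (edges (host m n)) \<le> (m + 1) * 2 ^ (m - 1) + (n - 2 ^ m)"
proof -
  have "(2::nat) ^ m = 2 * 2 ^ (m - 1)" using m by (cases m) auto
  then have one: "card ((\<lambda>v. {v, step m v i}) ` {..<2 ^ m}) = 2 ^ (m - 1)" for i
    using card_direction[OF m, of i] by simp
  have "edges (folded_cube m) = (\<Union>i\<le>m. (\<lambda>v. {v, step m v i}) ` {..<2 ^ m})"
    by (auto simp: folded_cube_def)
  then have "card (edges (folded_cube m)) \<le> (\<Sum>i\<le>m. card ((\<lambda>v. {v, step m v i}) ` {..<2 ^ m}))"
    by (simp add: card_UN_le)
  also have "\<dots> = (m + 1) * 2 ^ (m - 1)" unfolding one by simp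
  finally have "card (edges (folded_cube m)) \<le> (m + 1) * 2 ^ (m - 1)" .
  moreover have "card ((\<lambda>x. {x mod 2 ^ m, x}) ` {2 ^ m..<n}) \<le> n - 2 ^ m"
    using card_image_le[of "{2 ^ m..<n}" "\<lambda>x. {x mod 2 ^ m, x}"] by simp
  moreover have "card (edges (host m n)) \<le> card (edges (folded_cube m)) +
      card ((\<lambda>x. {x mod 2 ^ m, x}) ` {2 ^ m..<n})"
    unfolding host_def graph.sel by (rule card_Un_le)
  ultimately show ?thesis by linarith
qed

lemma folded_cube_edge_subset: "e \<in> edges (folded_cube m) \<Longrightarrow> e \<subseteq> {..<2 ^ m}"
  using step_less[of _ m] by (auto simp: folded_cube_def)

lemma folded_cube_neighbour:
  assumes "{x, y} \<in> edges (folded_cube m)"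
  shows "\<exists>i\<le>m. y = step m x i"
proof -
  obtain v i where vi: "{x, y} = {v, step m v i}" "i \<le> m"
    using assms by (auto simp: folded_cube_def)
  then consider "x = v" "y = step m v i" | "x = step m v i" "y = v"
    by (auto simp: doubleton_eq_iff)
  then show ?thesis using vi(2) by cases auto
qed

lemma direction_colouring_step:
  assumes m: "2 \<le> m" and v: "v < 2 ^ m" and i: "i \<le> m"
  shows "direction_colouring m {v, step m v i} = i"
proof -
  have "(THE j. j \<le> m \<and> (\<exists>w. {v, step m v i} = {w, step m w j})) = i"
  proof (rule the_equality)
    fix j assume j: "j \<le> m \<and> (\<exists>w. {v, step m v i} = {w, step m w j})"
    then obtain w where "{v, step m v i} = {w, step m w j}" by auto
    then have "step m v i = step m v j" by (auto simp: doubleton_eq_iff)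
    then show "j = i" using step_inj[OF m i] j by auto
  qed (use i in auto)
  then show ?thesis using v step_less[OF v, of i] by (simp add: direction_colouring_def)
qed

lemma direction_colouring_pendant:
  assumes "2 ^ m \<le> x"
  shows "direction_colouring m {x mod 2 ^ m, x} = Suc m + x"
proof -
  have "x mod 2 ^ m \<le> x" by simp
  then have "Max {x mod 2 ^ m, x} = x" by (simp add: max_absorb2)
  then show ?thesis using assms by (simp add: direction_colouring_def)
qed

lemma proper_direction_colouring:
  assumes m: "2 \<le> m"
  shows "proper_edge_colouring (host m n) (direction_colouring m)"
proof -
  have "e = f" if e: "e \<in> edges (host m n)" and f: "f \<in> edges (host m n)" and v: "v \<in> e" "v \<in> f"
    and c: "direction_colouring m e = direction_colouring m f" for e f v
  proof -
    have cases: "(\<exists>x i. x < 2 ^ m \<and> i \<le> m \<and> d = {x, step m x i} \<and> direction_colouring m d = i) \<or>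
      (\<exists>x. 2 ^ m \<le> x \<and> d = {x mod 2 ^ m, x} \<and> direction_colouring m d = Suc m + x)"
      if "d \<in> edges (host m n)" for d
      using that direction_colouring_step[OF m] direction_colouring_pendant[of m]
      by (fastforce simp: host_def folded_cube_def)
    from cases[OF e] show ?thesis
    proof
      assume "\<exists>x i. x < 2 ^ m \<and> i \<le> m \<and> e = {x, step m x i} \<and> direction_colouring m e = i"
      then obtain x i where x: "e = {x, step m x i}" "i \<le> m" "direction_colouring m e = i" by auto
      with cases[OF f] c obtain y where y: "f = {y, step m y i}" by auto
      then show ?thesis using step_edge_eq[of v x m i] step_edge_eq[of v y m i] v x(1) by simp
    next
      assume "\<exists>x. 2 ^ m \<le> x \<and> e = {x mod 2 ^ m, x} \<and> direction_colouring m e = Suc m + x"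
      then obtain x where x: "e = {x mod 2 ^ m, x}" "direction_colouring m e = Suc m + x" by auto
      then have "\<not> direction_colouring m f \<le> m" using c by simp
      with cases[OF f] obtain y where "f = {y mod 2 ^ m, y}" "direction_colouring m f = Suc m + y" by auto
      then show ?thesis using x c by simp
    qed
  qed
  then show ?thesis unfolding proper_edge_colouring_def by (metis disjoint_iff)
qed

section \<open>The direction colouring of the host has no rainbow copy\<close>

lemma path_is_trail:
  "ps \<noteq> [] \<Longrightarrow> set (path_edges ps) \<subseteq> edges (folded_cube m) \<Longrightarrow>
    \<exists>xs. set xs \<subseteq> {..m} \<and> ps = trail m (hd ps) xs"
proof (induction ps rule: path_edges.induct)
  case (1 x y zs)
  then obtain xs where xs: "set xs \<subseteq> {..m}" "y # zs = trail m y xs" by auto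
  obtain i where "i \<le> m" "y = step m x i" using 1 folded_cube_neighbour[of x y m] by auto
  then show ?case using xs by (intro exI[of _ "i # xs"]) auto
qed (auto intro: exI[of _ "[]"])

lemma direction_colouring_trail:
  assumes "2 \<le> m"
  shows "a < 2 ^ m \<Longrightarrow> set xs \<subseteq> {..m} \<Longrightarrow> trail_colours m (direction_colouring m) a xs = xs"
  by (induction xs arbitrary: a)
     (auto simp: path_edges_trail_Cons direction_colouring_step[OF assms] step_less simp del: trail.simps(2))

text \<open>Every central vertex has degree at least two, so the central path lies in the cube; being
  rainbow, it uses all \<open>m + 1\<close> directions and therefore closes up.\<close>
lemma host_no_rainbow_copy:
  assumes m: "2 \<le> m" and T: "simple_graph T" and vs: "distinct vs" "length vs = m + 2"
    "set vs \<subseteq> verts T" "set (path_edges vs) \<subseteq> edges T" "\<And>v. v \<in> set vs \<Longrightarrow> 2 \<le> degree T v"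
  shows "\<not> has_rainbow_copy (host m n) (direction_colouring m) T"
proof
  let ?c = "direction_colouring m"
  assume "has_rainbow_copy (host m n) ?c T"
  then obtain g where g: "inj_on g (verts T)" "\<And>e. e \<in> edges T \<Longrightarrow> g ` e \<in> edges (host m n)"
    "inj_on (\<lambda>e. ?c (g ` e)) (edges T)"
    using has_rainbow_copyD[OF T] by metis
  \<comment> \<open>At a pendant leaf the host has just one edge, but two edges of \<open>T\<close>
    at \<open>v\<close> have images of different colours.\<close>
  have less: "g v < 2 ^ m" if v: "v \<in> set vs" for v
  proof (rule ccontr)
    assume "\<not> g v < 2 ^ m"
    then have uniq: "e = {g v mod 2 ^ m, g v}" if "e \<in> edges (host m n)" "g v \<in> e" for e
      using that step_less[of _ m] by (auto simp: host_def folded_cube_def)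
    have "\<not> card {e \<in> edges T. v \<in> e} \<le> Suc 0" using vs(5)[OF v] by (simp add: degree_def)
    moreover have "finite {e \<in> edges T. v \<in> e}"
      using vs(5)[OF v] by (intro card_ge_0_finite) (simp add: degree_def)
    ultimately obtain e f where ef: "e \<in> edges T" "v \<in> e" "f \<in> edges T" "v \<in> f" "e \<noteq> f"
      by (auto simp: card_le_Suc0_iff_eq)
    then have "g ` e = g ` f" using uniq[OF g(2), of e] uniq[OF g(2), of f] by simp
    then show False using inj_onD[OF g(3) _ ef(1,3)] ef(5) by simp
  qed
  define ps where "ps = map g vs"
  have "path_edges ps = map ((`) g) (path_edges vs)" by (simp add: ps_def path_edges_map)
  then have "distinct (map ?c (path_edges ps)) \<longleftrightarrow> distinct (map (\<lambda>e. ?c (g ` e)) (path_edges vs))"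
    by (simp add: comp_def)
  moreover have "distinct (path_edges vs)"
    unfolding distinct_conv_nth using vs(1)
    by (auto simp: nth_path_edges doubleton_eq_iff nth_eq_iff_index_eq)
  ultimately have rb: "distinct (map ?c (path_edges ps))"
    using g(3) vs(4) by (simp add: distinct_map inj_on_subset)
  have dps: "distinct ps" unfolding ps_def using vs g(1) by (simp add: distinct_map inj_on_subset)
  have lps: "length ps = m + 2" using vs by (simp add: ps_def)
  have "set (path_edges ps) \<subseteq> edges (folded_cube m)"
  proof
    fix e assume e: "e \<in> set (path_edges ps)"
    then have "e \<subseteq> {..<2 ^ m}" using path_edges_subset[OF e] less by (auto simp: ps_def)
    moreover have "e \<in> edges (host m n)" using e vs(4) g(2) by (auto simp: ps_def path_edges_map)
    ultimately show "e \<in> edges (folded_cube m)" by (auto simp: host_def)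
  qed
  then obtain xs where xs: "set xs \<subseteq> {..m}" "ps = trail m (hd ps) xs"
    using path_is_trail[of ps m] lps by (metis add_is_0 list.size(3) zero_neq_numeral)
  have "hd ps \<in> set ps" using lps by (cases ps) auto
  then have a: "hd ps < 2 ^ m" using less by (auto simp: ps_def)
  have "length xs = Suc m" using lps xs(2) by (metis length_trail add_2_eq_Suc' nat.inject)
  moreover have "distinct xs"
    using rb direction_colouring_trail[OF m a xs(1)] xs(2) by metis
  ultimately have all: "set xs = {..m}"
    using xs(1) by (intro card_subset_eq) (auto simp: distinct_card)
  have "walk m (hd ps) xs = hd ps"
    unfolding walk_eq_iff[OF a xs(1)] using \<open>distinct xs\<close> all by (simp add: count_list_distinct)
  then have "last ps = hd ps" using xs(2) by (metis last_trail)
  then have "ps ! (m + 1) = ps ! 0" 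
    using lps last_conv_nth[of ps] hd_conv_nth[of ps] by fastforce
  then show False using dps lps by (simp add: nth_eq_iff_index_eq)
qed

section \<open>Every added edge creates a rainbow copy\<close>

text \<open>Either some cube path with \<open>m + 1\<close> edges is rainbow and serves as central
  path, or all cube vertices see the same colour set \<open>K\<close> and the new edge is joined to
  a rainbow cube path with \<open>m\<close> edges.\<close>

lemma host_rainbow_copy:
  assumes m: "2 \<le> m" and n: "(card (verts T) + 1) * 2 ^ m \<le> n"
    and T: "simple_graph T" "distinct (vs @ [w])" "finite L" "L \<inter> set (vs @ [w]) = {}"
      "verts T = set (vs @ [w]) \<union> L" "p ` L \<subseteq> set (butlast vs)"
      "edges T = set (path_edges (vs @ [w])) \<union> (\<lambda>u. {u, p u}) ` L"
    and len: "length vs = m + 2"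
    and uv: "u < n" "v < n" "u \<noteq> v" "{u, v} \<notin> edges (host m n)"
    and proper: "proper_edge_colouring (add_edge (host m n) u v) c"
  shows "has_rainbow_copy (add_edge (host m n) u v) c T"
proof -
  let ?G = "add_edge (host m n) u v"
  let ?N = "(2::nat) ^ m"
  have eG: "edges ?G = insert {u, v} (edges (host m n))" and vG: "verts ?G = {..<n}"
    by (auto simp: add_edge_def host_def)
  have cube: "edges (folded_cube m) \<subseteq> edges ?G" unfolding eG by (auto simp: host_def)
  have pend: "{a, x} \<in> edges ?G" if "x \<in> pendants m n a" for a x
    using that unfolding eG by (auto simp: host_def pendants_def)
  have Nn: "?N \<le> n" using n by (simp add: algebra_simps)
  have many: "card (verts T) \<le> card (pendants m n a)" if "a < ?N" for a
    using card_pendants[OF that n] .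
  have "card (set (vs @ [w])) \<le> card (verts T)" using T(3,5) by (intro card_mono) auto
  then have cT: "m + 3 \<le> card (verts T)" using distinct_card[OF T(2)] len by simp
  have pc: "proper_edge_colouring (folded_cube m) c"
    by (rule proper_edge_colouring_mono[OF proper cube])
  \<comment> \<open>The spine has \<open>m + 3\<close> vertices and carries further leaves only at
    its first \<open>m + 1\<close>; hence only these must lie in the cube, where the pools are
    attached.\<close>
  have copy: "has_rainbow_copy ?G c T"
    if "length ps = m + 3" "distinct ps" "set ps \<subseteq> {..<n}" "set (path_edges ps) \<subseteq> edges ?G"
      "distinct (map c (path_edges ps))" "set (take (m + 1) ps) \<subseteq> {..<?N}" for ps
  proof (rule rainbow_caterpillar[OF T(1) T(2) T(3) T(4) T(5) _ T(7) proper,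
        where A = "{..<?N}" and N = "pendants m n"])
    show "p ` L \<subseteq> set (take (length (vs @ [w]) - 2) (vs @ [w]))"
      using T(6) len by (simp add: butlast_conv_take)
    show "pendants m n a \<inter> pendants m n b = {}" if "a \<noteq> b" for a b
      using that by (auto simp: pendants_def)
    show "finite (pendants m n a) \<and> pendants m n a \<subseteq> verts ?G - {..<?N} \<and>
        card (verts T) \<le> card (pendants m n a)" if "a \<in> {..<?N}" for a
      using many that by (auto simp: pendants_def vG)
  qed (use that len pend vG in auto)
  \<comment> \<open>A central path inside the cube uses \<open>m + 1\<close> colours, and its end
    has at least \<open>m + 3\<close> pendant edges, so one of them completes the spine.\<close>
  have copy_core: "has_rainbow_copy ?G c T"
    if ps: "length ps = m + 2" "distinct ps" "set ps \<subseteq> {..<?N}" "set (path_edges ps) \<subseteq> edges ?G"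
      "distinct (map c (path_edges ps))" for ps
  proof -
    have ne: "ps \<noteq> []" using ps(1) by auto
    then have l: "last ps < ?N" using ps(3) by (meson last_in_set lessThan_iff subsetD)
    have "card (set (map c (path_edges ps))) \<le> m + 1"
      using card_length[of "map c (path_edges ps)"] ps(1) by simp
    then obtain x where x: "x \<in> pendants m n (last ps)" "c {last ps, x} \<notin> set (map c (path_edges ps))"
      using fresh_neighbour[OF proper pend, of "pendants m n (last ps)" "last ps" "set (map c (path_edges ps))"]
        many[OF l] cT by auto
    have "x \<notin> {..<?N}" "x < n" using x(1) by (auto simp: pendants_def)
    then show ?thesis using ps ne x pend[OF x(1)] Nn
      by (intro copy[of "ps @ [x]"]) (auto simp: path_edges_snoc dest: in_set_takeD)
  qed
  show ?thesis
  proof (cases "\<exists>a xs. a < ?N \<and> length xs = Suc m \<and> rainbow_path m c a xs")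
    case True
    then obtain a xs where xs: "a < ?N" "length xs = Suc m" "rainbow_path m c a xs" by blast
    then have "set (path_edges (trail m a xs)) \<subseteq> edges ?G"
      using path_edges_trail_subset[OF xs(1)] cube by (auto simp: rainbow_path_def)
    then show ?thesis using xs set_trail_less[OF xs(1)]
      by (intro copy_core[of "trail m a xs"]) (auto simp: rainbow_path_def)
  next
    case False
    define K where "K = colours_at m c 0"
    have K: "colours_at m c a = K" if "a < ?N" for a
      using that
    proof (induction rule: folded_cube_induct)
      case (step a i)
      then show ?case using colours_at_step[OF m pc] False by blast
    qed (simp add: K_def)
    \<comment> \<open>The cube edges at \<open>a\<close> already use up all of \<open>K\<close>, so
      properness keeps every other edge at \<open>a\<close> out of \<open>K\<close>.\<close>
    have fresh: "c {a, x} \<notin> K" if a: "a < ?N" and ax: "{a, x} \<in> edges ?G" "{a, x} \<notin> edges (folded_cube m)" for a x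
    proof
      assume "c {a, x} \<in> K"
      then obtain i where i: "i \<le> m" "c {a, x} = c {a, step m a i}"
        using K[OF a] by (auto simp: colours_at_def)
      have "{a, step m a i} \<in> edges (folded_cube m)" using a i by (intro folded_cube_edgeI)
      moreover from this have "{a, x} = {a, step m a i}"
        using ax(1) cube i(2) by (intro proper_edge_colouringD[OF proper, of _ _ a]) auto
      ultimately show False using ax(2) by simp
    qed
    have path: "set (path_edges (trail m a xs)) \<subseteq> edges ?G" "set (trail_colours m c a xs) \<subseteq> K"
      "distinct (trail m a xs)" "distinct (trail_colours m c a xs)" "set (trail m a xs) \<subseteq> {..<?N}"
      if "a < ?N" "rainbow_path m c a xs" for a xs
    proof -
      have s: "set xs \<subseteq> {..m}" using that by (simp add: rainbow_path_def)
      show "set (path_edges (trail m a xs)) \<subseteq> edges ?G"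
        using path_edges_trail_subset[OF that(1) s] cube by blast
      show "set (trail_colours m c a xs) \<subseteq> K" by (rule trail_colours_subset[OF that(1) s K])
    qed (use that set_trail_less in \<open>auto simp: rainbow_path_def\<close>)
    \<comment> \<open>If the new edge has an end \<open>x\<close> outside the cube, the spine
      follows a cube path with \<open>m\<close> edges to the cube neighbour \<open>a\<close> of
      \<open>x\<close>, then goes to \<open>x\<close> and to \<open>y\<close>.\<close>
    have leaf: "has_rainbow_copy ?G c T"
      if xy: "{x, y} = {u, v}" and x: "?N \<le> x" for x y
    proof -
      define a where "a = x mod ?N"
      have a: "a < ?N" by (simp add: a_def)
      have lt: "x < n" "y < n" "x \<noteq> y" using xy uv(1-3) by (auto simp: doubleton_eq_iff)
      have xp: "x \<in> pendants m n a" using x lt by (simp add: pendants_def a_def)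
      have ya: "y \<noteq> a"
        using uv(4) xy[symmetric] x lt by (auto simp: host_def a_def insert_commute)
      have xyE: "{x, y} \<in> edges ?G" using xy eG by simp
      have out: "{z, x} \<notin> edges (folded_cube m)" for z
        using x folded_cube_edge_subset[of "{z, x}" m] by auto
      have ax: "c {a, x} \<notin> K" by (rule fresh[OF a pend[OF xp] out])
      have ne: "c {a, x} \<noteq> c {x, y}"
        using proper_edge_colouringD[OF proper pend[OF xp] xyE, of x] ya lt
        by (auto simp: doubleton_eq_iff)
      have "\<exists>xs. length xs = m \<and> rainbow_path m c a xs \<and> y \<notin> set (trail m a xs) \<and>
        c {x, y} \<notin> set (trail_colours m c a xs)"
      \<comment> \<open>For \<open>y\<close> in the cube the colour of \<open>{x, y}\<close> is
        outside \<open>K\<close>, so only the vertex \<open>y\<close> is to be avoided; for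
        \<open>y\<close> outside, no cube path meets it and only the colour is to be
        avoided.\<close>
      proof (cases "y < ?N")
        case True
        have "c {x, y} \<notin> K" using fresh[OF True, of x] xyE out[of y] by (simp add: insert_commute)
        then show ?thesis
          using rainbow_path_avoiding_vertex[OF m pc a ya] path(2)[OF a] by blast
      next
        case False
        then have "y \<notin> set (trail m a xs)" for xs using set_trail_less[OF a, of xs] by auto
        then show ?thesis using rainbow_path_avoiding_colour[OF m pc a, of "c {x, y}"] by blast
      qed
      then obtain xs where xs: "length xs = m" "rainbow_path m c a xs" "y \<notin> set (trail m a xs)"
        "c {x, y} \<notin> set (trail_colours m c a xs)" by blast
      note p = path[OF a xs(2)]
      have pe: "path_edges (rev (trail m a xs) @ [x, y]) =
        rev (path_edges (trail m a xs)) @ [{a, x}, {x, y}]"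
        using path_edges_snoc[of "rev (trail m a xs) @ [x]" y]
        by (simp add: path_edges_snoc path_edges_rev last_rev)
      have cpe: "map c (path_edges (rev (trail m a xs) @ [x, y])) =
        rev (trail_colours m c a xs) @ [c {a, x}, c {x, y}]" unfolding pe by (simp add: rev_map)
      show ?thesis
      proof (rule copy[of "rev (trail m a xs) @ [x, y]"])
        show "distinct (rev (trail m a xs) @ [x, y])" using p(3,5) xs(3) x lt by auto
        show "set (rev (trail m a xs) @ [x, y]) \<subseteq> {..<n}" using p(5) lt Nn by auto
        show "set (path_edges (rev (trail m a xs) @ [x, y])) \<subseteq> edges ?G"
          unfolding pe using p(1) pend[OF xp] xyE by auto
        show "distinct (map c (path_edges (rev (trail m a xs) @ [x, y])))"
          unfolding cpe using p(2,4) xs(4) ax ne by auto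
        show "set (take (m + 1) (rev (trail m a xs) @ [x, y])) \<subseteq> {..<?N}" using p(5) xs(1) by simp
      qed (use xs(1) in simp)
    qed
    consider "?N \<le> u" | "?N \<le> v" | "u < ?N" "v < ?N" by linarith
    then show ?thesis
    proof cases
      case 3
      \<comment> \<open>With both ends in the cube, a path with \<open>m\<close> edges from
        \<open>u\<close> avoiding \<open>v\<close>, prolonged by the new edge whose colour is
        outside \<open>K\<close>, is a central path inside the cube.\<close>
      obtain xs where xs: "length xs = m" "rainbow_path m c u xs" "v \<notin> set (trail m u xs)"
        using rainbow_path_avoiding_vertex[OF m pc 3(1), of v] uv(3) by blast
      note p = path[OF 3(1) xs(2)]
      have "c {u, v} \<notin> K" by (rule fresh[OF 3(1)]) (use uv(4) eG in \<open>auto simp: host_def\<close>)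
      moreover have pe: "path_edges (rev (trail m u xs) @ [v]) = rev (path_edges (trail m u xs)) @ [{u, v}]"
        by (simp add: path_edges_snoc path_edges_rev last_rev)
      moreover have "map c (path_edges (rev (trail m u xs) @ [v])) =
        rev (trail_colours m c u xs) @ [c {u, v}]" unfolding pe by (simp add: rev_map)
      ultimately show ?thesis using p xs 3 eG by (intro copy_core[of "rev (trail m u xs) @ [v]"]) auto
    qed (use leaf[of u v] leaf[of v u] in \<open>auto simp: insert_commute\<close>)
  qed
qed

theorem theorem1p3:
  fixes T :: "'a graph" and vs :: "'a list" and k l n :: nat
  assumes "l \<ge> 4"
    and "k \<ge> l + 2"
    and "caterpillar T"
    and "card (verts T) = k"
    and "central_path T vs"
    and "length vs = l"
    and "degree T (vs ! (l - 1)) = 2"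
    and "n \<ge> (k + 1) * 2 ^ (l - 2)"
  shows "sat_star n T \<le> n + (l - 3) * 2 ^ (l - 3)"
proof -
  define m where "m = l - 2"
  have m: "2 \<le> m" and l: "l = m + 2" using assms(1) by (auto simp: m_def)
  have "vs \<noteq> []" using assms(1,6) by auto
  then have deg: "degree T (last vs) = 2" using assms(6,7) by (simp add: last_conv_nth)
  have len: "4 \<le> length vs" using assms(1,6) by simp
  obtain w p L where T: "simple_graph T" "distinct (vs @ [w])" "finite L" "L \<inter> set (vs @ [w]) = {}"
    "verts T = set (vs @ [w]) \<union> L" "p ` L \<subseteq> set (butlast vs)"
    "edges T = set (path_edges (vs @ [w])) \<union> (\<lambda>u. {u, p u}) ` L"
    "\<And>v. v \<in> set vs \<Longrightarrow> 2 \<le> degree T v"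
    by (rule caterpillar_structure[OF assms(3,5) len deg], rule that)
  have n: "(card (verts T) + 1) * 2 ^ m \<le> n" using assms(4,8) by (simp add: m_def)
  then have Nn: "2 ^ m \<le> n" by (simp add: algebra_simps)
  let ?G = "host m n"
  have verts: "verts ?G = {..<n}" by (simp add: host_def)
  have lv: "length vs = m + 2" using assms(6) l by simp
  have "\<not> has_rainbow_copy ?G (direction_colouring m) T"
    by (rule host_no_rainbow_copy[OF m T(1) _ lv])
      (use T(2,5,7,8) \<open>vs \<noteq> []\<close> in \<open>auto simp: path_edges_snoc\<close>)
  then have "properly_rainbow_saturated T ?G"
    unfolding properly_rainbow_saturated_def verts
    using simple_host[OF m Nn] proper_direction_colouring[OF m] host_rainbow_copy[OF m n T(1-7) lv]
    by blast
  moreover have "card (verts ?G) = n" by (simp add: verts)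
  ultimately have "sat_star n T \<le> card (edges ?G)"
    unfolding sat_star_def by (intro Least_le) blast
  also have "\<dots> \<le> (m + 1) * 2 ^ (m - 1) + (n - 2 ^ m)" by (rule card_edges_host[OF m])
  also have "\<dots> = n + (l - 3) * 2 ^ (l - 3)"
  proof -
    \<comment> \<open>Here \<open>l - 3 = m - 1\<close>. Writing \<open>m = Suc j\<close> exposes
      \<open>2 ^ m = 2 * 2 ^ j\<close>, which lowers the factor \<open>m + 1\<close> to
      \<open>m - 1\<close>; \<open>Nn\<close> makes the subtraction from \<open>n\<close>
      exact.\<close>
    obtain j where "m = Suc j" using m by (cases m) auto
    then show ?thesis using Nn l by (simp add: algebra_simps)
  qed
  finally show ?thesis .
qed

end
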